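(* The image of $\mathcal{F}$ in $\mathrm{Homeo}([0,1])$ is contained in $\bar F$, where $\bar F$ is viewed as a subgroup of $\mathrm{Homeo}([0,1])$.
   Context: $F$ (R. Thompson's group) is the group of all piecewise-linear increasing self-homeomorphisms of $[0,1]$ with finitely many break points of the derivative, all lying in $\mathbb{Z}[\frac12]$, and with all slopes powers of $2$. The group $\bar F$. Let $\mu$ be Lebesgue measure on $[0,1]$. The Hamming metric on $F$ is $\mathrm{dist}_H(f,g)=\mu(\{x\mid f(x)\ne g(x)\}) + \mu(\{x\mid f^{-1}(x)\ne g^{-1}(x)\})$ (the same formula is used on $\mathrm{Homeo}([0,1])$). $\bar F$ is the Raĭkov completion of $F$ with respect to $\mathrm{dist}_H$: equivalence classes of $\mathrm{dist}_H$-Cauchy sequences in $F$, with $(f_n)\sim(g_n)$ if $\mathrm{dist}_H(f_n,g_n)\to0$, and termwise multiplication. Every Cauchy sequence $(f_n)$ in $F$ has a pointwise limit which is a homeomorphism of $[0,1]$, and sending the class of $(f_n)$ to its pointwise limit is an injective homomorphism $\bar F\to\mathrm{Homeo}([0,1])$ extending the inclusion of $F$; in this way $\bar F$ is viewed as a subgroup of $\mathrm{Homeo}([0,1])$. The group $\mathcal{F}$. Consider (finite or infinite) rooted full binary trees: every vertex is a leaf or has exactly two children, the left edge being labeled $0$ and the right edge $1$. A branch is a maximal simple path starting at the root, identified with its (finite or infinite) binary label; branches are ordered left to right (lexicographically). For a finite binary word $p$, $[p]$ denotes the interval $[.p,.p1^{\mathbb{N}}]$ (binary expansions); an infinite branch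 $\omega$ corresponds to the single point $.\omega$. $\mathcal{F}$ consists of the triples $(T_+,T_-,\phi)$, where $T_+,T_-$ are such binary trees with the same finite number of infinite branches, and $\phi$ is an order-preserving (left to right) bijection from the branches of $T_+$ to the branches of $T_-$ taking infinite branches to infinite branches; triples are taken modulo inserting/reducing pairs of common carets (a caret being a vertex with two children, common if it occurs at corresponding branches of both trees). Each triple defines a homeomorphism of $[0,1]$ mapping $[p]$ linearly onto $[\phi(p)]$ for every finite branch $p$ of $T_+$ and $.\omega$ to $.\phi(\omega)$ for every infinite branch $\omega$. This gives an embedding of $\mathcal{F}$ in $\mathrm{Homeo}([0,1])$ extending the inclusion of $F$ (the triples with both trees finite). *)

theory Defs
  imports "HOL-Analysis.Analysis" "HOL-Algebra.Bij" "HOL-Library.Stream"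
begin

section \<open>Homeomorphisms of the unit interval\<close>

text \<open>Homeomorphisms of \<open>[0,1]\<close> are represented by functions on the reals that are
  \<^const>\<open>undefined\<close> outside \<open>[0,1]\<close>, so that equality is equality on \<open>[0,1]\<close>.\<close>

definition Homeo01 :: "(real \<Rightarrow> real) monoid" where
  "Homeo01 = BijGroup {0..1}
     \<lparr>carrier := {f \<in> Bij {0..1}. \<exists>g. homeomorphism {0..1} {0..1} f g}\<rparr>"

definition hamming_dist :: "(real \<Rightarrow> real) \<Rightarrow> (real \<Rightarrow> real) \<Rightarrow> real" where
  "hamming_dist f g =
     measure lebesgue {x \<in> {0..1}. f x \<noteq> g x} +
     measure lebesgue {x \<in> {0..1}. inv_into {0..1} f x \<noteq> inv_into {0..1} g x}"


section \<open>Thompson's group \<open>F\<close>\<close>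

definition dyadic :: "real set" where
  "dyadic = {of_int m / 2 ^ n | (m :: int) (n :: nat). True}"

text \<open>\<open>B\<close> is a finite set of subdivision points containing all the break points.\<close>

definition thompson_F :: "(real \<Rightarrow> real) set" where
  "thompson_F = {f \<in> carrier Homeo01. strict_mono_on {0..1} f \<and>
     (\<exists>B. finite B \<and> {0, 1} \<subseteq> B \<and> B \<subseteq> dyadic \<inter> {0..1} \<and>
       (\<forall>a\<in>B. \<forall>b\<in>B. a < b \<and> {a<..<b} \<inter> B = {} \<longrightarrow>
         (\<exists>k :: int. \<forall>x\<in>{a..b}. f x = f a + 2 powi k * (x - a))))}"


section \<open>The Raikov completion of \<open>F\<close>\<close>

definition F_cauchy :: "(nat \<Rightarrow> real \<Rightarrow> real) set" where
  "F_cauchy = {s. Metric_space.MCauchy thompson_F hamming_dist s}"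

definition F_cauchy_rel :: "((nat \<Rightarrow> real \<Rightarrow> real) \<times> (nat \<Rightarrow> real \<Rightarrow> real)) set" where
  "F_cauchy_rel = {(s, r). s \<in> F_cauchy \<and> r \<in> F_cauchy \<and>
     (\<lambda>n. hamming_dist (s n) (r n)) \<longlonglongrightarrow> 0}"

definition F_bar :: "(nat \<Rightarrow> real \<Rightarrow> real) set monoid" where
  "F_bar =
     \<lparr>carrier = F_cauchy // F_cauchy_rel,
      mult = \<lambda>C D. \<Union>s\<in>C. \<Union>r\<in>D. F_cauchy_rel `` {\<lambda>n. s n \<otimes>\<^bsub>Homeo01\<^esub> r n},
      one = F_cauchy_rel `` {\<lambda>n. \<one>\<^bsub>Homeo01\<^esub>}\<rparr>"

definition pointwise_lim :: "(nat \<Rightarrow> real \<Rightarrow> real) \<Rightarrow> real \<Rightarrow> real" where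
  "pointwise_lim s = (\<lambda>x\<in>{0..1}. lim (\<lambda>n. s n x))"

text \<open>The embedding of the completion into \<^const>\<open>Homeo01\<close>: all representatives of a class
  have the same pointwise limit.\<close>

definition F_bar_homeo :: "(nat \<Rightarrow> real \<Rightarrow> real) set \<Rightarrow> real \<Rightarrow> real" where
  "F_bar_homeo C = the_elem (pointwise_lim ` C)"


section \<open>Binary trees and branches\<close>

text \<open>A vertex is the word of edge labels on the path from the root, with \<^const>\<open>False\<close> for
  \<open>0\<close> (left) and \<^const>\<open>True\<close> for \<open>1\<close> (right); a tree is its set of vertices.\<close>

definition full_binary_tree :: "bool list set \<Rightarrow> bool" where
  "full_binary_tree T \<longleftrightarrow> [] \<in> T \<and> (\<forall>p b. p @ [b] \<in> T \<longrightarrow> p \<in> T) \<and>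
     (\<forall>p. p @ [False] \<in> T \<longleftrightarrow> p @ [True] \<in> T)"

datatype branch = FinBr "bool list" | InfBr "bool stream"

definition leaves :: "bool list set \<Rightarrow> bool list set" where
  "leaves T = {p \<in> T. \<forall>b. p @ [b] \<notin> T}"

definition ends :: "bool list set \<Rightarrow> bool stream set" where
  "ends T = {w. \<forall>n. stake n w \<in> T}"

definition branches :: "bool list set \<Rightarrow> branch set" where
  "branches T = FinBr ` leaves T \<union> InfBr ` ends T"

fun letter :: "branch \<Rightarrow> nat \<Rightarrow> bool option" where
  "letter (FinBr p) n = (if n < length p then Some (p ! n) else None)"
| "letter (InfBr w) n = Some (w !! n)"

text \<open>No branch of a tree is a proper prefix of another one, so this is the lexicographic
  order on the branches of a tree.\<close>

definition left_of :: "branch \<Rightarrow> branch \<Rightarrow> bool" where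
  "left_of u v \<longleftrightarrow> (\<exists>n. (\<forall>i<n. letter u i = letter v i) \<and>
     letter u n = Some False \<and> letter v n = Some True)"


section \<open>The group of tree triples\<close>

type_synonym tree_triple = "bool list set \<times> bool list set \<times> (branch \<Rightarrow> branch)"

definition tree_triples :: "tree_triple set" where
  "tree_triples = {(T, U, \<phi>). full_binary_tree T \<and> full_binary_tree U \<and>
     finite (ends T) \<and> finite (ends U) \<and> card (ends T) = card (ends U) \<and>
     \<phi> \<in> extensional (branches T) \<and> bij_betw \<phi> (branches T) (branches U) \<and>
     (\<forall>u\<in>branches T. \<forall>v\<in>branches T. left_of u v \<longrightarrow> left_of (\<phi> u) (\<phi> v)) \<and>
     (\<forall>w\<in>ends T. \<phi> (InfBr w) \<in> InfBr ` ends U)}"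

text \<open>Insertion of common carets: below each leaf \<open>p\<close> of \<open>T\<close> and the corresponding leaf \<open>q\<close>
  of \<open>U\<close> one hangs the same tree. Infinitely many carets may be inserted at once; this is
  needed for the map to homeomorphisms to be injective, since for instance the identity is
  also represented by two copies of an infinite tree.\<close>

definition caret_insertion :: "(tree_triple \<times> tree_triple) set" where
  "caret_insertion = {((T, U, \<phi>), (T', U', \<phi>')).
     (T, U, \<phi>) \<in> tree_triples \<and> (T', U', \<phi>') \<in> tree_triples \<and> T \<subseteq> T' \<and> U \<subseteq> U' \<and>
     (\<forall>p\<in>leaves T. \<forall>q. \<phi> (FinBr p) = FinBr q \<longrightarrow>
        (\<forall>s. p @ s \<in> T' \<longleftrightarrow> q @ s \<in> U') \<and>
        (\<forall>s. p @ s \<in> leaves T' \<longrightarrow> \<phi>' (FinBr (p @ s)) = FinBr (q @ s)) \<and>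
        (\<forall>w. p @- w \<in> ends T' \<longrightarrow> \<phi>' (InfBr (p @- w)) = InfBr (q @- w))) \<and>
     (\<forall>w\<in>ends T. \<phi>' (InfBr w) = \<phi> (InfBr w))}"

definition tree_F :: "tree_triple set set" where
  "tree_F = tree_triples // (caret_insertion \<union> caret_insertion\<inverse>)\<^sup>*"

definition binval :: "bool stream \<Rightarrow> real" where
  "binval w = (\<Sum>n. of_bool (w !! n) / 2 ^ Suc n)"

definition lo :: "bool list \<Rightarrow> real" where
  "lo p = binval (p @- sconst False)"

definition hi :: "bool list \<Rightarrow> real" where
  "hi p = binval (p @- sconst True)"

definition induces :: "tree_triple \<Rightarrow> (real \<Rightarrow> real) \<Rightarrow> bool" where
  "induces = (\<lambda>(T, U, \<phi>) h.
     (\<forall>p\<in>leaves T. \<forall>q. \<phi> (FinBr p) = FinBr q \<longrightarrow>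
        (\<forall>x\<in>{lo p..hi p}. h x = lo q + (hi q - lo q) / (hi p - lo p) * (x - lo p))) \<and>
     (\<forall>w\<in>ends T. \<forall>v. \<phi> (InfBr w) = InfBr v \<longrightarrow> h (binval w) = binval v))"

definition triple_homeo :: "tree_triple \<Rightarrow> real \<Rightarrow> real" where
  "triple_homeo t = (THE h. h \<in> carrier Homeo01 \<and> induces t h)"

text \<open>All representatives of a class define the same homeomorphism.\<close>

definition tree_F_homeo :: "tree_triple set \<Rightarrow> real \<Rightarrow> real" where
  "tree_F_homeo C = the_elem (triple_homeo ` C)"


section \<open>Basic facts\<close>

lemma subgroup_Homeo01: "subgroup (carrier Homeo01) (BijGroup {0..1})"
proof -
  interpret G: group "BijGroup {0..1::real}" by (rule group_BijGroup)
  have C: "carrier Homeo01 = {f \<in> Bij {0..1}. \<exists>g. homeomorphism {0..1} {0..1} f g}"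
    by (simp add: Homeo01_def)
  show ?thesis
  proof (rule G.subgroupI)
    show "carrier Homeo01 \<subseteq> carrier (BijGroup {0..1})"
      by (auto simp: C BijGroup_def)
    have "homeomorphism {0..1} {0..1} (\<lambda>x\<in>{0..1::real}. x) (\<lambda>x. x)"
      using homeomorphism_ident by (rule homeomorphism_cong) auto
    then have "(\<lambda>x\<in>{0..1}. x) \<in> carrier Homeo01"
      unfolding C using id_Bij by blast
    then show "carrier Homeo01 \<noteq> {}" by blast
  next
    fix f assume "f \<in> carrier Homeo01"
    then obtain g where fB: "f \<in> Bij {0..1}" and h: "homeomorphism {0..1} {0..1} f g"
      by (auto simp: C)
    have inj: "inj_on f {0..1}" using fB by (auto simp: Bij_def bij_betw_def)
    have eq: "inv_into {0..1} f x = g x" if "x \<in> {0..1}" for x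
      using h inj that by (metis homeomorphism_def image_eqI inv_into_f_eq)
    have inv: "inv\<^bsub>BijGroup {0..1}\<^esub> f = (\<lambda>x\<in>{0..1}. inv_into {0..1} f x)"
      using fB by (rule inv_BijGroup)
    have "homeomorphism {0..1} {0..1} (\<lambda>x\<in>{0..1}. inv_into {0..1} f x) f"
      using homeomorphism_symD[OF h] by (rule homeomorphism_cong) (auto simp: eq)
    then show "inv\<^bsub>BijGroup {0..1}\<^esub> f \<in> carrier Homeo01"
      unfolding inv C using restrict_inv_into_Bij[OF fB] by auto
  next
    fix f f' assume "f \<in> carrier Homeo01" "f' \<in> carrier Homeo01"
    then obtain g g' where B: "f \<in> Bij {0..1}" "f' \<in> Bij {0..1}"
      and h: "homeomorphism {0..1} {0..1} f g" "homeomorphism {0..1} {0..1} f' g'"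
      by (auto simp: C)
    have "homeomorphism {0..1} {0..1} (compose {0..1} f f') (g' \<circ> g)"
      using homeomorphism_compose[OF h(2,1)]
      by (rule homeomorphism_cong) (auto simp: compose_def)
    then show "f \<otimes>\<^bsub>BijGroup {0..1}\<^esub> f' \<in> carrier Homeo01"
      using B by (auto simp: C BijGroup_def compose_Bij)
  qed
qed

lemma group_Homeo01: "group Homeo01"
proof -
  have "Homeo01 = (BijGroup {0..1})\<lparr>carrier := carrier Homeo01\<rparr>"
    by (simp add: Homeo01_def)
  then show ?thesis
    using subgroup.subgroup_is_group[OF subgroup_Homeo01 group_BijGroup] by simp
qed

lemma Homeo01_continuous:
  assumes "f \<in> carrier Homeo01"
  shows "continuous_on {0..1} f" "continuous_on {0..1} (inv_into {0..1} f)"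
proof -
  obtain g where fB: "f \<in> Bij {0..1}" and h: "homeomorphism {0..1} {0..1} f g"
    using assms by (auto simp: Homeo01_def)
  have inj: "inj_on f {0..1}" using fB by (auto simp: Bij_def bij_betw_def)
  have eq: "inv_into {0..1} f x = g x" if "x \<in> {0..1}" for x
    using h inj that by (metis homeomorphism_def image_eqI inv_into_f_eq)
  show "continuous_on {0..1} f" using h by (simp add: homeomorphism_def)
  have "continuous_on {0..1} g" using h by (simp add: homeomorphism_def)
  then show "continuous_on {0..1} (inv_into {0..1} f)"
    using continuous_on_cong[of "{0..1}" "{0..1}" "inv_into {0..1} f" g] eq by simp
qed

lemma differ_openin:
  fixes f g :: "real \<Rightarrow> real"
  assumes "continuous_on {0..1} f" "continuous_on {0..1} g"
  obtains V where "open V" "{x \<in> {0..1}. f x \<noteq> g x} = {0..1} \<inter> V"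
proof -
  have "continuous_on {0..1} (\<lambda>x. f x - g x)"
    using assms by (intro continuous_intros)
  then have "openin (top_of_set {0..1}) ({0..1} \<inter> (\<lambda>x. f x - g x) -` (- {0}))"
    by (rule continuous_openin_preimage_gen) (simp add: open_Compl)
  moreover have "{0..1} \<inter> (\<lambda>x. f x - g x) -` (- {0}) = {x \<in> {0..1}. f x \<noteq> g x}"
    by auto
  ultimately show thesis using that by (auto simp: openin_open)
qed

lemma differ_lmeasurable:
  fixes f g :: "real \<Rightarrow> real"
  assumes "continuous_on {0..1} f" "continuous_on {0..1} g"
  shows "{x \<in> {0..1}. f x \<noteq> g x} \<in> lmeasurable"
proof -
  obtain V where "open V" and V: "{x \<in> {0..1}. f x \<noteq> g x} = {0..1} \<inter> V"
    using differ_openin[OF assms] .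
  show ?thesis unfolding V
    using \<open>open V\<close> by (intro fmeasurable_Int_fmeasurable) auto
qed

lemma differ_measure_0:
  fixes f g :: "real \<Rightarrow> real"
  assumes "continuous_on {0..1} f" "continuous_on {0..1} g"
    and "measure lebesgue {x \<in> {0..1}. f x \<noteq> g x} = 0" and "x \<in> {0..1}"
  shows "f x = g x"
proof (rule ccontr)
  assume ne: "f x \<noteq> g x"
  obtain V where "open V" and V: "{x \<in> {0..1}. f x \<noteq> g x} = {0..1} \<inter> V"
    using differ_openin[OF assms(1,2)] .
  have "negligible ({0..1} \<inter> V)"
    using assms(3) differ_lmeasurable[OF assms(1,2)] unfolding V
    by (simp add: negligible_iff_measure)
  then have "negligible ({0<..<1} \<inter> V)"
    by (rule negligible_subset) auto
  then have "{0<..<1} \<inter> V = {}"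
    using open_not_negligible[of "{0<..<1} \<inter> V"] \<open>open V\<close> by (metis open_Int open_greaterThanLessThan)
  then have "closure {0<..<1} \<inter> V = {}"
    using \<open>open V\<close> open_Int_closure_eq_empty[of V "{0<..<1}"] by (metis Int_commute)
  moreover have "x \<in> V" using ne assms(4) V by auto
  ultimately show False using assms(4) by (auto simp: disjoint_iff)
qed

lemma differ_triangle:
  fixes f g h :: "real \<Rightarrow> real"
  assumes "continuous_on {0..1} f" "continuous_on {0..1} g" "continuous_on {0..1} h"
  shows "measure lebesgue {x \<in> {0..1}. f x \<noteq> h x} \<le>
    measure lebesgue {x \<in> {0..1}. f x \<noteq> g x} + measure lebesgue {x \<in> {0..1}. g x \<noteq> h x}"
proof -
  have "measure lebesgue {x \<in> {0..1}. f x \<noteq> h x} \<le>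
    measure lebesgue ({x \<in> {0..1}. f x \<noteq> g x} \<union> {x \<in> {0..1}. g x \<noteq> h x})"
    using assms by (intro measure_mono_fmeasurable fmeasurable.Un differ_lmeasurable fmeasurableD) auto
  also have "\<dots> \<le>
    measure lebesgue {x \<in> {0..1}. f x \<noteq> g x} + measure lebesgue {x \<in> {0..1}. g x \<noteq> h x}"
    using assms by (intro measure_Un_le fmeasurableD differ_lmeasurable)
  finally show ?thesis .
qed

lemma Metric_space_Homeo01: "Metric_space (carrier Homeo01) hamming_dist"
proof
  fix f g
  show "0 \<le> hamming_dist f g" by (simp add: hamming_dist_def)
  show "hamming_dist f g = hamming_dist g f" by (simp add: hamming_dist_def eq_commute)
next
  fix f g assume f: "f \<in> carrier Homeo01" and g: "g \<in> carrier Homeo01"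
  show "hamming_dist f g = 0 \<longleftrightarrow> f = g"
  proof
    assume "hamming_dist f g = 0"
    then have "measure lebesgue {x \<in> {0..1}. f x \<noteq> g x} = 0"
      unfolding hamming_dist_def by (smt (verit) measure_nonneg)
    then have "\<And>x. x \<in> {0..1} \<Longrightarrow> f x = g x"
      using differ_measure_0 Homeo01_continuous f g by blast
    moreover have "f \<in> extensional {0..1}" "g \<in> extensional {0..1}"
      using f g by (auto simp: Homeo01_def Bij_def)
    ultimately show "f = g" by (meson extensionalityI)
  qed (simp add: hamming_dist_def)
next
  fix f g h assume "f \<in> carrier Homeo01" "g \<in> carrier Homeo01" "h \<in> carrier Homeo01"
  then show "hamming_dist f h \<le> hamming_dist f g + hamming_dist g h"
    using differ_triangle[of f g h]
      differ_triangle[of "inv_into {0..1} f" "inv_into {0..1} g" "inv_into {0..1} h"]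
      Homeo01_continuous
    by (simp add: hamming_dist_def)
qed

text \<open>Hence \<^const>\<open>Metric_space.MCauchy\<close> in \<^const>\<open>F_cauchy\<close> has its intended meaning.\<close>

lemma Metric_space_thompson_F: "Metric_space thompson_F hamming_dist"
  by (rule Metric_space.subspace[OF Metric_space_Homeo01]) (auto simp: thompson_F_def)

lemma F_cauchy_iff:
  "s \<in> F_cauchy \<longleftrightarrow> range s \<subseteq> thompson_F \<and>
     (\<forall>e>0. \<exists>N. \<forall>n n'. N \<le> n \<longrightarrow> N \<le> n' \<longrightarrow> hamming_dist (s n) (s n') < e)"
  by (simp add: F_cauchy_def Metric_space.MCauchy_def[OF Metric_space_thompson_F])

end

theory Submission
  imports Defs
begin

text \<open>
  Let \<open>h\<close> be the homeomorphism of a tree triple \<open>(T, U, \<phi>)\<close>. On the interval of each leaf of \<open>T\<close> it is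
  affine with slope a power of two and with dyadic end points and values, exactly like an element
  of Thompson's group; only the leaves may be infinitely many. But their intervals cover \<open>[0,1]\<close> up
  to the finitely many points given by the infinite branches. So one keeps \<open>h\<close> on the leaves of depth
  at most \<open>n\<close> and replaces it on the finitely many remaining gaps by any piecewise-linear map
  with dyadic breaks and slopes powers of two that has the same end values. This gives elements of
  Thompson's group which differ from \<open>h\<close> only on a set whose measure tends to \<open>0\<close>, and the same holds
  for the inverses (\<open>triple_homeo_approx\<close>). Hence \<open>h\<close> is a Hamming limit of elements of the group.

  Filling the gaps rests on an explicit map with a single break between any two
  dyadic intervals (\<open>dyadic_PL_between\<close>). It is affine whenever the ratio of
  the lengths is a power of two, so interpolating \<open>h\<close> at the end points of the chosen leaves
  automatically reproduces \<open>h\<close> on those leaves (\<open>dyadic_PL_interpolation\<close>).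

  A Hamming limit is the image of an element of the completion because the Hamming metric dominates
  the uniform metric on increasing homeomorphisms (\<open>hamming_dist_bound\<close>): all Cauchy sequences in the
  class of the approximating sequence converge uniformly to \<open>h\<close> (\<open>hamming_limit_in_F_bar\<close>).

  The remaining work is to see that the homeomorphism of a triple exists, is unique and increasing
  (\<open>triple_homeo_exists\<close>, \<open>induces_unique\<close>) and depends only on the class of the triple
  (\<open>caret_insertion_induces\<close>). Existence is the delicate point: the affine pieces on the
  leaves and the values at the ends form a monotone relation from \<open>[0,1]\<close> onto \<open>[0,1]\<close> with
  countable sections, and such a relation is the graph of an increasing bijection, since a jump or a
  flat piece would contain an uncountable interval (\<open>monotone_relation_homeo\<close>).
\<close>

section \<open>Binary expansions\<close>

lemma binval_summable: "summable (\<lambda>n. of_bool (w !! n) / 2 ^ Suc n :: real)"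
proof (rule summable_comparison_test')
  show "summable (\<lambda>n. (1/2) ^ n :: real)" by (rule summable_geometric) simp
  show "norm (of_bool (w !! n) / 2 ^ Suc n :: real) \<le> (1/2) ^ n" if "n \<ge> 0" for n
    by (auto simp: power_divide divide_simps)
qed

lemma binval_Stream: "binval (b ## w) = of_bool b / 2 + binval w / 2"
proof -
  have "binval (b ## w) = (\<Sum>n. of_bool ((b ## w) !! Suc n) / 2 ^ Suc (Suc n)) + of_bool b / 2"
    using suminf_split_head[OF binval_summable, of "b ## w"] unfolding binval_def by simp
  also have "(\<Sum>n. of_bool ((b ## w) !! Suc n) / 2 ^ Suc (Suc n) :: real)
      = (\<Sum>n. of_bool (w !! n) / 2 ^ Suc n / 2)"
    by (simp add: mult.commute)
  also have "\<dots> = binval w / 2"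
    unfolding binval_def by (rule suminf_divide[OF binval_summable])
  finally show ?thesis by simp
qed

lemma binval_bounds: "0 \<le> binval w" "binval w \<le> 1"
proof -
  show "0 \<le> binval w" unfolding binval_def
    by (rule suminf_nonneg[OF binval_summable]) simp
  have "binval w \<le> (\<Sum>n. (1/2) ^ Suc n)" unfolding binval_def
    using power_half_series[THEN sums_summable]
    by (intro suminf_le binval_summable) (auto simp: power_one_over divide_simps)
  also have "\<dots> = 1" using power_half_series by (rule sums_unique[symmetric])
  finally show "binval w \<le> 1" .
qed

lemma binval_sconst: "binval (sconst False) = 0" "binval (sconst True) = 1"
proof -
  have "sconst b = b ## sconst b" for b :: bool
    by (subst siterate.code) simp
  then have "binval (sconst b) = of_bool b / 2 + binval (sconst b) / 2" for b
    by (metis binval_Stream)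
  from this[of False] this[of True]
  show "binval (sconst False) = 0" "binval (sconst True) = 1" by simp_all
qed

lemma lo_Nil: "lo [] = 0" and lo_Cons: "lo (b # p) = of_bool b / 2 + lo p / 2"
  by (simp_all add: lo_def binval_sconst binval_Stream)

lemma binval_shift: "binval (p @- w) = lo p + binval w / 2 ^ length p"
  by (induction p) (simp_all add: lo_Nil lo_Cons binval_Stream add_divide_distrib)

lemma hi_eq: "hi p = lo p + 1 / 2 ^ length p"
  by (simp add: hi_def binval_shift binval_sconst)

lemma lo_append: "lo (p @ s) = lo p + lo s / 2 ^ length p"
  using binval_shift[of p "s @- sconst False"] by (simp add: lo_def)

lemma hi_append: "hi (p @ s) = lo p + hi s / 2 ^ length p"
  using binval_shift[of p "s @- sconst True"] by (simp add: hi_def)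

lemma lo_hi_bounds: "0 \<le> lo p" "lo p < hi p" "hi p \<le> 1"
  using binval_bounds by (auto simp: lo_def hi_def) (simp add: binval_shift binval_sconst)

text \<open>The two values lie on the two sides of the midpoint of the interval of the common prefix of
  length \<open>n\<close>. Equality is possible, as in \<open>.0111\<dots> = .1000\<dots>\<close>.\<close>

lemma binval_lex_le:
  assumes "\<And>i. i < n \<Longrightarrow> w !! i = w' !! i" "\<not> w !! n" "w' !! n"
  shows "binval w \<le> binval w'"
proof -
  have dec: "binval v = lo (stake n v) + binval (v !! n ## sdrop (Suc n) v) / 2 ^ n" for v
    using binval_shift[of "stake n v" "v !! n ## sdrop (Suc n) v"]
    by (metis id_stake_snth_sdrop length_stake)
  have "stake n w = stake n w'"
    using assms(1) by (intro nth_equalityI) auto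
  moreover have "binval (w !! n ## sdrop (Suc n) w) \<le> binval (w' !! n ## sdrop (Suc n) w')"
    using assms(2,3) binval_bounds[of "sdrop (Suc n) w"] binval_bounds[of "sdrop (Suc n) w'"]
    by (simp add: binval_Stream)
  ultimately show ?thesis
    by (simp add: dec[of w] dec[of w'] divide_right_mono)
qed

text \<open>The digits are the parities of \<open>\<lfloor>2\<^sup>n\<^sup>+\<^sup>1 x\<rfloor>\<close>; they produce the expansion with infinitely many
  zeros, so the point \<open>1\<close> needs the constant stream instead.\<close>

lemma binval_surj:
  assumes "0 \<le> x" "x \<le> 1"
  obtains w where "binval w = x"
proof (cases "x = 1")
  case True
  then show ?thesis using that binval_sconst by auto
next
  case False
  define w where "w = smap (\<lambda>n. odd \<lfloor>2 ^ Suc n * x\<rfloor>) nats"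
  \<comment> \<open>doubling the scale appends one binary digit to the integer part\<close>
  have digit: "\<lfloor>2 ^ Suc n * x\<rfloor> = 2 * \<lfloor>2 ^ n * x\<rfloor> + of_bool (w !! n)" for n
  proof -
    have half: "\<lfloor>2 ^ n * x\<rfloor> = \<lfloor>2 ^ Suc n * x\<rfloor> div 2"
      using floor_divide_real_eq_div[of 2 "2 ^ Suc n * x"] by simp
    have parity: "k = 2 * (k div 2) + of_bool (odd k)" for k :: int
      by (cases "even k") auto
    have digit: "w !! n = odd \<lfloor>2 ^ Suc n * x\<rfloor>"
      by (simp add: w_def)
    show ?thesis unfolding half digit by (rule parity)
  qed
  have partial: "(\<Sum>i<n. of_bool (w !! i) / 2 ^ Suc i) = of_int \<lfloor>2 ^ n * x\<rfloor> / (2 ^ n :: real)" for n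
  proof (induction n)
    case 0
    have "\<lfloor>x\<rfloor> = 0" using assms False by (simp add: floor_eq_iff)
    then show ?case by simp
  next
    case (Suc n)
    then show ?case using digit[of n] by (simp add: add_divide_distrib)
  qed
  have "(\<lambda>n. of_int \<lfloor>2 ^ n * x\<rfloor> / (2 ^ n :: real)) \<longlonglongrightarrow> x"
  proof (rule real_tendsto_sandwich)
    have "(\<lambda>n. x - (1/2) ^ n) \<longlonglongrightarrow> x - 0"
      by (intro tendsto_intros LIMSEQ_power_zero) simp
    then show "(\<lambda>n. x - (1/2) ^ n) \<longlonglongrightarrow> x" by simp
    have "(2 ^ n * x - 1) / 2 ^ n \<le> \<lfloor>2 ^ n * x\<rfloor> / 2 ^ n" "\<lfloor>2 ^ n * x\<rfloor> / 2 ^ n \<le> 2 ^ n * x / 2 ^ n" for n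
      by (intro divide_right_mono; linarith?; simp)+
    then show "\<forall>\<^sub>F n in sequentially. x - (1/2) ^ n \<le> \<lfloor>2 ^ n * x\<rfloor> / 2 ^ n"
      "\<forall>\<^sub>F n in sequentially. \<lfloor>2 ^ n * x\<rfloor> / 2 ^ n \<le> x"
      by (auto simp: diff_divide_distrib power_one_over)
  qed simp
  then have "(\<lambda>n. of_bool (w !! n) / 2 ^ Suc n :: real) sums x"
    unfolding sums_def partial .
  then have "binval w = x" unfolding binval_def by (rule sums_unique[symmetric])
  then show ?thesis using that by blast
qed

section \<open>Trees and branches\<close>

lemma tree_prefix: "full_binary_tree T \<Longrightarrow> p @ s \<in> T \<Longrightarrow> p \<in> T"
  by (induction s rule: rev_induct) (auto simp: full_binary_tree_def simp flip: append_assoc)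

lemma leafI: "full_binary_tree T \<Longrightarrow> p \<in> T \<Longrightarrow> p @ [b] \<notin> T \<Longrightarrow> p \<in> leaves T"
  unfolding full_binary_tree_def leaves_def by (auto, (metis (full_types))+)

text \<open>Walking down a tree along a stream, the last vertex before one leaves the tree is a leaf,
  because in a full tree a missing child means that both children are missing.\<close>

lemma stream_follows_branch:
  assumes "full_binary_tree T" "stake n w \<notin> T"
  obtains k where "stake k w \<in> leaves T" "k < n"
proof -
  define m where "m = (LEAST m. stake m w \<notin> T)"
  have m: "stake m w \<notin> T" "m \<le> n" and le: "\<And>k. stake k w \<notin> T \<Longrightarrow> m \<le> k"
    unfolding m_def using LeastI[of "\<lambda>m. stake m w \<notin> T", OF assms(2)] assms(2)
    by (auto intro: Least_le)
  obtain k where k: "m = Suc k"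
    using m(1) assms(1) by (cases m) (auto simp: full_binary_tree_def)
  have "stake k w \<in> T" using le[of k] k by auto
  then have "stake k w \<in> leaves T"
    using m(1) k leafI[OF assms(1), of "stake k w" "w !! k"]
    by (simp add: stake_Suc del: stake.simps)
  then show ?thesis using that k m(2) by auto
qed

lemma ends_subtree_cases:
  assumes "full_binary_tree T"
  obtains "w \<in> ends T" | p v where "p \<in> leaves T" "w = p @- v"
proof (cases "w \<in> ends T")
  case False
  then obtain n where "stake n w \<notin> T" by (auto simp: ends_def)
  then obtain k where "stake k w \<in> leaves T"
    using stream_follows_branch[OF assms] by metis
  then show ?thesis using that(2) by (metis stake_sdrop)
qed

text \<open>The cell of a branch is the set of values of the streams that run along it. It is a
  nondegenerate interval for a leaf and a point for an end; the cells of a tree tile \<open>[0,1]\<close> from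
  left to right, with overlaps at end points only.\<close>

fun cell :: "branch \<Rightarrow> real set" where
  "cell (FinBr p) = {lo p..hi p}"
| "cell (InfBr w) = {binval w}"

text \<open>The prescription for the homeomorphism on one cell. A triple matches leaves with leaves
  and ends with ends; the values for mixed pairs are arbitrary.\<close>

fun cell_map :: "branch \<Rightarrow> branch \<Rightarrow> real \<Rightarrow> real" where
  "cell_map (FinBr p) (FinBr q) x = lo q + (hi q - lo q) / (hi p - lo p) * (x - lo p)"
| "cell_map _ (InfBr v) x = binval v"
| "cell_map (InfBr w) _ x = undefined"

text \<open>This is the form in which cells are compared: each point of a cell has a binary expansion
  that extends the word of the branch.\<close>

lemma mem_cellE:
  assumes "x \<in> cell u"
  obtains w where "x = binval w" "\<And>i b. letter u i = Some b \<Longrightarrow> w !! i = b"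
proof (cases u)
  case (FinBr p)
  then have "0 \<le> (x - lo p) * 2 ^ length p" "(x - lo p) * 2 ^ length p \<le> 1"
    using assms by (auto simp: hi_eq field_simps)
  then obtain w where "binval w = (x - lo p) * 2 ^ length p" by (rule binval_surj)
  then have "x = binval (p @- w)" by (simp add: binval_shift)
  moreover have "(p @- w) !! i = b" if "letter u i = Some b" for i b
    using that FinBr by (auto split: if_splits simp: shift_snth_less)
  ultimately show ?thesis using that by blast
next
  case (InfBr w)
  then show ?thesis using assms that[of w] by auto
qed

lemma cell_subset: "cell u \<subseteq> {0..1}"
proof
  fix x assume "x \<in> cell u"
  then show "x \<in> {0..1}" using binval_bounds by (auto elim: mem_cellE)
qed

lemma branches_cover:
  assumes "full_binary_tree T" "x \<in> {0..1}"
  obtains u where "u \<in> branches T" "x \<in> cell u"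
proof -
  obtain w where w: "binval w = x" using assms(2) binval_surj by auto
  show ?thesis
  proof (rule ends_subtree_cases[OF assms(1), of w])
    assume "w \<in> ends T"
    then show ?thesis using that[of "InfBr w"] w by (auto simp: branches_def)
  next
    fix p v assume "p \<in> leaves T" "w = p @- v"
    then show ?thesis using that[of "FinBr p"] w binval_bounds[of v]
      by (auto simp: branches_def binval_shift hi_eq divide_right_mono)
  qed
qed

lemma left_of_cells:
  assumes "left_of u v" "x \<in> cell u" "y \<in> cell v"
  shows "x \<le> y"
proof -
  obtain n where n: "\<forall>i<n. letter u i = letter v i" "letter u n = Some False" "letter v n = Some True"
    using assms(1) by (auto simp: left_of_def)
  obtain w where w: "x = binval w" "\<And>i b. letter u i = Some b \<Longrightarrow> w !! i = b"
    using mem_cellE[OF assms(2)] by metis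
  obtain w' where w': "y = binval w'" "\<And>i b. letter v i = Some b \<Longrightarrow> w' !! i = b"
    using mem_cellE[OF assms(3)] by metis
  have "w !! i = w' !! i" if "i < n" for i
  proof -
    have "\<exists>b. letter u i = Some b" using n(2) that by (cases u) (auto split: if_splits)
    then show ?thesis using w(2) w'(2) n(1) that by metis
  qed
  then show ?thesis using binval_lex_le[of n w w'] w w' n(2,3) by auto
qed

lemma branch_eqI:
  assumes "\<And>i. letter u i = letter v i"
  shows "u = v"
proof (cases u; cases v)
  fix p q assume uv: "u = FinBr p" "v = FinBr q"
  have "i < length p \<longleftrightarrow> i < length q" for i
    using assms[of i] uv by (auto split: if_splits)
  then have "length p = length q" by (metis linorder_neqE_nat less_irrefl)
  moreover have "p ! i = q ! i" if "i < length p" for i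
    using assms[of i] uv that by (auto split: if_splits)
  ultimately show "u = v" using uv by (simp add: nth_equalityI)
next
  fix p w assume "u = FinBr p" "v = InfBr w"
  then show "u = v" using assms[of "length p"] by simp
next
  fix p w assume "u = InfBr w" "v = FinBr p"
  then show "u = v" using assms[of "length p"] by simp
next
  fix w w' assume "u = InfBr w" "v = InfBr w'"
  then show "u = v" using assms by (metis letter.simps(2) option.inject stream_smap_nats ext)
qed

text \<open>If a branch ended at a vertex through which another branch continues, the next vertex of the
  latter would be a child of a leaf. So two branches first differ at a position where both have a
  letter, which makes \<^const>\<open>left_of\<close> total on the branches of a tree.\<close>

lemma branch_not_prefix:
  assumes T: "full_binary_tree T" "u \<in> branches T" "v \<in> branches T"
    and agree: "\<And>i. i < n \<Longrightarrow> letter u i = letter v i"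
    and u: "letter u n = None" and v: "letter v n = Some b"
  shows False
proof -
  obtain p where p: "u = FinBr p" using u by (cases u) auto
  have "\<not> length p < n"
  proof
    assume "length p < n"
    moreover from this have "letter v (length p) = None" using agree p by fastforce
    ultimately show False using v by (cases v) (auto split: if_splits)
  qed
  then have "length p = n"
    using agree[of "length p"] u p by (cases "length p < n") (auto split: if_splits)
  have "p @ [b] \<in> T"
  proof (cases v)
    case (FinBr q)
    then have "n < length q" "q ! n = b" using v by (auto split: if_splits)
    moreover have "take n q = p"
      using agree p FinBr \<open>length p = n\<close> \<open>n < length q\<close> by (intro nth_equalityI) force+
    ultimately have "take (Suc n) q = p @ [b]" by (simp add: take_Suc_conv_app_nth)
    then obtain s where "q = (p @ [b]) @ s" by (metis append_take_drop_id)
    moreover have "q \<in> T" using T(3) FinBr by (auto simp: branches_def leaves_def)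
    ultimately show ?thesis using tree_prefix[OF T(1), of "p @ [b]" s] by simp
  next
    case (InfBr w)
    have "w !! i = p ! i" if "i < n" for i
      using agree[OF that] that p InfBr \<open>length p = n\<close> by simp
    then have "stake n w = p"
      using \<open>length p = n\<close> by (intro nth_equalityI) auto
    then have "stake (Suc n) w = p @ [b]" using v InfBr by (simp add: stake_Suc del: stake.simps)
    moreover have "stake (Suc n) w \<in> T"
      using T(3) InfBr by (auto simp: branches_def ends_def simp del: stake.simps)
    ultimately show ?thesis by simp
  qed
  moreover have "p \<in> leaves T" using T(2) p by (auto simp: branches_def)
  ultimately show False by (auto simp: leaves_def)
qed

lemma left_of_total:
  assumes T: "full_binary_tree T" "u \<in> branches T" "v \<in> branches T" and "u \<noteq> v"
  shows "left_of u v \<or> left_of v u"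
proof -
  define n where "n = (LEAST n. letter u n \<noteq> letter v n)"
  obtain k where "letter u k \<noteq> letter v k" using branch_eqI \<open>u \<noteq> v\<close> by blast
  then have ne: "letter u n \<noteq> letter v n" unfolding n_def by (rule LeastI)
  have agree: "letter u i = letter v i" if "i < n" for i
    using not_less_Least that unfolding n_def by blast
  have "letter u n \<noteq> None" "letter v n \<noteq> None"
    using branch_not_prefix[OF T, of n] branch_not_prefix[OF T(1,3,2), of n] ne agree
    by fastforce+
  then have "letter u n = Some False \<and> letter v n = Some True \<or>
      letter u n = Some True \<and> letter v n = Some False"
    using ne by auto
  then show ?thesis using agree unfolding left_of_def by metis
qed

lemma countable_branches: "finite (ends T) \<Longrightarrow> countable (branches T)"
  by (auto simp: branches_def intro: countable_finite)

section \<open>Increasing bijections of the unit interval\<close>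

text \<open>Extended by the identity, the map becomes an increasing bijection of the whole line, and
  there the continuity criterion for monotone maps with open image applies.\<close>

lemma increasing_bijection_continuous:
  fixes f :: "real \<Rightarrow> real"
  assumes mono: "strict_mono_on {0..1} f" and onto: "f ` {0..1} = {0..1}"
  shows "continuous_on {0..1} f"
proof -
  define F where "F = (\<lambda>x. if x \<in> {0..1} then f x else x)"
  have range: "f x \<in> {0..1}" if "x \<in> {0..1}" for x using onto that by blast
  have "F x \<le> F y" if "x \<le> y" for x y
    using that strict_mono_on_leD[OF mono, of x y] range[of x] range[of y]
    by (auto simp: F_def)
  moreover have "F ` UNIV = UNIV"
  proof -
    have "y \<in> F ` UNIV" for y
    proof (cases "y \<in> {0..1}")
      case True
      then obtain x where "x \<in> {0..1}" "f x = y" using onto by (metis imageE)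
      then show ?thesis by (intro image_eqI[of _ _ x]) (auto simp: F_def)
    qed (intro image_eqI[of _ _ y]; auto simp: F_def)
    then show ?thesis by blast
  qed
  ultimately have "continuous_on UNIV F" by (intro continuous_onI_mono) auto
  then have "continuous_on {0..1} F" by (rule continuous_on_subset) simp
  then show ?thesis by (rule continuous_on_eq) (simp add: F_def)
qed

lemma increasing_bijection_Homeo01:
  assumes "strict_mono_on {0..1} f" "f ` {0..1} = {0..1}" "f \<in> extensional {0..1}"
  shows "f \<in> carrier Homeo01"
proof -
  have inj: "inj_on f {0..1}" using assms(1) by (rule strict_mono_on_imp_inj_on)
  then have "f \<in> Bij {0..1}" using assms by (simp add: Bij_def bij_betw_def)
  moreover obtain g where "homeomorphism {0..1} {0..1} f g"
    using homeomorphism_compact[OF compact_Icc _ assms(2) inj] 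
      increasing_bijection_continuous[OF assms(1,2)] by blast
  ultimately show ?thesis by (auto simp: Homeo01_def)
qed

lemma Homeo01_bij: "f \<in> carrier Homeo01 \<Longrightarrow> bij_betw f {0..1} {0..1}"
  and Homeo01_extensional: "f \<in> carrier Homeo01 \<Longrightarrow> f \<in> extensional {0..1}"
  by (auto simp: Homeo01_def Bij_def)

text \<open>Suppose that \<open>x\<close> is related to \<open>y\<close> and \<open>y'\<close> with \<open>y < y'\<close>. Every \<open>z\<close> strictly between them is related
  to some point, and by monotonicity this point can be neither smaller nor larger than \<open>x\<close>. Then \<open>x\<close>
  would be related to all of the uncountably many \<open>z\<close>.\<close>

lemma monotone_relation_functional:
  fixes G :: "(real \<times> real) set"
  assumes chain: "\<And>x y x' y'. (x, y) \<in> G \<Longrightarrow> (x', y') \<in> G \<Longrightarrow> x < x' \<Longrightarrow> y \<le> y'"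
    and range: "Range G = {0..1}"
    and countable: "\<And>x. countable {y. (x, y) \<in> G}"
    and "(x, y) \<in> G" "(x, y') \<in> G"
  shows "y = y'"
proof -
  have "\<not> y < y'" if G: "(x, y) \<in> G" "(x, y') \<in> G" for y y'
  proof
    assume "y < y'"
    have "(x, z) \<in> G" if "z \<in> {y<..<y'}" for z
    proof -
      have "{y, y'} \<subseteq> {0..1}" using G range by blast
      then have "z \<in> Range G" using that range by auto
      then obtain x' where "(x', z) \<in> G" by blast
      moreover have "x' = x"
        using chain[OF G(1) \<open>(x', z) \<in> G\<close>] chain[OF \<open>(x', z) \<in> G\<close> G(2)]
          chain[OF \<open>(x', z) \<in> G\<close> G(1)] chain[OF G(2) \<open>(x', z) \<in> G\<close>] that
        by (cases x' x rule: linorder_cases) auto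
      ultimately show ?thesis by simp
    qed
    then have "countable {y<..<y'}"
      by (intro countable_subset[OF _ countable[of x]]) blast
    then show False using uncountable_open_interval \<open>y < y'\<close> by blast
  qed
  from this[OF assms(4,5)] this[OF assms(5,4)] show ?thesis by simp
qed

text \<open>Monotonicity is symmetric in the two coordinates (by contraposition), so the argument above
  applies to the relation and to its converse: it is the graph of an increasing bijection.\<close>

lemma monotone_relation_homeo:
  fixes G :: "(real \<times> real) set"
  assumes chain: "\<And>x y x' y'. (x, y) \<in> G \<Longrightarrow> (x', y') \<in> G \<Longrightarrow> x < x' \<Longrightarrow> y \<le> y'"
    and domain: "Domain G = {0..1}" and range: "Range G = {0..1}"
    and countable: "\<And>x. countable {y. (x, y) \<in> G}" "\<And>y. countable {x. (x, y) \<in> G}"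
  obtains h where "h \<in> carrier Homeo01" "strict_mono_on {0..1} h"
    "\<And>x y. (x, y) \<in> G \<Longrightarrow> h x = y"
proof -
  have single: "y = y'" if "(x, y) \<in> G" "(x, y') \<in> G" for x y y'
    using monotone_relation_functional[OF chain range countable(1) that] .
  have inj: "x = x'" if "(x, y) \<in> G" "(x', y) \<in> G" for x x' y
  proof (rule monotone_relation_functional[of "G\<inverse>" y x x'])
    show "v \<le> v'" if "(u, v) \<in> G\<inverse>" "(u', v') \<in> G\<inverse>" "u < u'" for u v u' v'
      using chain[of v' u' v u] that by fastforce
  qed (use that domain countable(2) in auto)
  have "\<exists>y. (x, y) \<in> G" if "x \<in> {0..1}" for x using that domain by blast
  then obtain g where g: "\<And>x. x \<in> {0..1} \<Longrightarrow> (x, g x) \<in> G" by metis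
  define h where "h = restrict g {0..1}"
  have h: "(x, h x) \<in> G" if "x \<in> {0..1}" for x using g that by (simp add: h_def)
  have graph: "h x = y" if "(x, y) \<in> G" for x y
    using single[OF h that] that domain by blast
  have mono: "strict_mono_on {0..1} h"
  proof (rule strict_mono_onI)
    fix x y :: real assume xy: "x \<in> {0..1}" "y \<in> {0..1}" "x < y"
    then have "h x \<le> h y" using chain[OF h h] by blast
    moreover have "h x \<noteq> h y" using inj[OF h, of x y] h[of y] xy by auto
    ultimately show "h x < h y" by simp
  qed
  have "h ` {0..1} = {0..1}"
  proof
    show "h ` {0..1} \<subseteq> {0..1}" using h range by blast
    show "{0..1} \<subseteq> h ` {0..1}"
    proof
      fix y :: real assume "y \<in> {0..1}"
      then obtain x where "(x, y) \<in> G" using range by blast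
      then show "y \<in> h ` {0..1}" using graph domain by blast
    qed
  qed
  then have "h \<in> carrier Homeo01"
    using mono by (intro increasing_bijection_Homeo01) (auto simp: h_def)
  then show ?thesis using that mono graph by blast
qed

section \<open>The homeomorphism of a tree triple\<close>

definition same_kind :: "branch \<Rightarrow> branch \<Rightarrow> bool" where
  "same_kind u v \<longleftrightarrow> (\<exists>p q. u = FinBr p \<and> v = FinBr q) \<or> (\<exists>w w'. u = InfBr w \<and> v = InfBr w')"

lemma triple_end:
  assumes "(T, U, \<phi>) \<in> tree_triples" "w \<in> ends T"
  obtains v where "v \<in> ends U" "\<phi> (InfBr w) = InfBr v"
  using assms by (auto simp: tree_triples_def)

text \<open>Finiteness of the sets of ends is what makes the leaves go to leaves: the injection of the
  ends of \<open>T\<close> into the equally many ends of \<open>U\<close> is onto, so no end of \<open>U\<close> is left for a leaf.\<close>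

lemma triple_leaf:
  assumes t: "(T, U, \<phi>) \<in> tree_triples" and p: "p \<in> leaves T"
  obtains q where "q \<in> leaves U" "\<phi> (FinBr p) = FinBr q"
proof -
  have bij: "bij_betw \<phi> (branches T) (branches U)"
    and fin: "finite (ends U)" "card (ends T) = card (ends U)"
    using t by (auto simp: tree_triples_def)
  have "\<phi> ` InfBr ` ends T = InfBr ` ends U"
  proof (rule card_subset_eq)
    show "\<phi> ` InfBr ` ends T \<subseteq> InfBr ` ends U" using t by (auto simp: tree_triples_def)
    have "inj_on \<phi> (InfBr ` ends T)"
      using bij by (auto simp: bij_betw_def branches_def intro: inj_on_subset)
    then show "card (\<phi> ` InfBr ` ends T) = card (InfBr ` ends U)"
      using fin by (simp add: card_image inj_on_def[of InfBr])
  qed (use fin in auto)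
  moreover have "\<phi> (FinBr p) \<notin> \<phi> ` InfBr ` ends T"
  proof
    assume "\<phi> (FinBr p) \<in> \<phi> ` InfBr ` ends T"
    then obtain w where "w \<in> ends T" "\<phi> (FinBr p) = \<phi> (InfBr w)" by auto
    then show False
      using inj_onD[of \<phi> "branches T" "FinBr p" "InfBr w"] bij_betw_imp_inj_on[OF bij] p
      by (simp add: branches_def)
  qed
  moreover have "\<phi> (FinBr p) \<in> branches U"
    using bij_betwE[OF bij] p by (simp add: branches_def)
  ultimately show ?thesis using that by (auto simp: branches_def)
qed

lemma triple_same_kind:
  assumes "(T, U, \<phi>) \<in> tree_triples" "u \<in> branches T"
  shows "same_kind u (\<phi> u)"
  using assms by (auto simp: branches_def same_kind_def elim: triple_leaf triple_end)

lemma cell_map_FinBr: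
  "cell_map (FinBr p) (FinBr q) x = lo q + 2 ^ length p / 2 ^ length q * (x - lo p)"
  by (simp add: hi_eq)

lemma cell_map_strict_mono:
  "same_kind u v \<Longrightarrow> strict_mono_on (cell u) (cell_map u v)"
  by (auto simp: same_kind_def strict_mono_on_def cell_map_FinBr divide_strict_right_mono
      simp del: cell_map.simps(1))

lemma cell_map_image:
  assumes "same_kind u v"
  shows "cell_map u v ` cell u = cell v"
proof -
  have "cell_map (FinBr p) (FinBr q) ` {lo p..hi p} = {lo q..hi q}" for p q
  proof -
    define c :: real where "c = 2 ^ length p / 2 ^ length q"
    have c: "c > 0" "c * (hi p - lo p) = hi q - lo q" by (simp_all add: c_def hi_eq)
    have "(\<lambda>x. lo q + c * (x - lo p)) ` {lo p..hi p} = {lo q..hi q}"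
    proof
      have "c * (x - lo p) \<le> hi q - lo q" if "x \<le> hi p" for x
        using c that by (metis mult_left_mono diff_right_mono less_imp_le)
      then show "(\<lambda>x. lo q + c * (x - lo p)) ` {lo p..hi p} \<subseteq> {lo q..hi q}"
        using c(1) by (fastforce simp: le_diff_eq add.commute)
      have "(y - lo q) / c \<le> hi p - lo p" if "y \<le> hi q" for y
        using c that by (simp add: pos_divide_le_eq mult.commute)
      then show "{lo q..hi q} \<subseteq> (\<lambda>x. lo q + c * (x - lo p)) ` {lo p..hi p}"
        using c(1) by (intro subsetI image_eqI[of _ _ "lo p + (_ - lo q) / c"])
          (auto simp: le_diff_eq add.commute)
    qed
    moreover have "cell_map (FinBr p) (FinBr q) = (\<lambda>x. lo q + c * (x - lo p))"
      unfolding c_def cell_map_FinBr ..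
    ultimately show ?thesis by simp
  qed
  then show ?thesis using assms unfolding same_kind_def
    by (elim disjE exE conjE) (simp_all del: cell_map.simps(1))
qed

lemma induces_iff:
  assumes t: "(T, U, \<phi>) \<in> tree_triples"
  shows "induces (T, U, \<phi>) h \<longleftrightarrow> (\<forall>u\<in>branches T. \<forall>x\<in>cell u. h x = cell_map u (\<phi> u) x)"
proof (intro iffI ballI)
  fix u x assume h: "induces (T, U, \<phi>) h" and "u \<in> branches T" and x: "x \<in> cell u"
  then consider p where "p \<in> leaves T" "u = FinBr p" | w where "w \<in> ends T" "u = InfBr w"
    by (auto simp: branches_def)
  then show "h x = cell_map u (\<phi> u) x"
  proof cases
    case 1
    moreover obtain q where "\<phi> (FinBr p) = FinBr q" using triple_leaf[OF t 1(1)] .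
    ultimately show ?thesis using h x by (simp add: induces_def)
  next
    case 2
    moreover obtain v where "\<phi> (InfBr w) = InfBr v" using triple_end[OF t 2(1)] .
    ultimately show ?thesis using h x by (simp add: induces_def)
  qed
next
  assume "\<forall>u\<in>branches T. \<forall>x\<in>cell u. h x = cell_map u (\<phi> u) x"
  then show "induces (T, U, \<phi>) h" by (auto simp: induces_def branches_def ball_Un)
qed

text \<open>Gluing the maps of the single cells. Neighbouring cells share end points, and ends may
  share their point with a neighbouring leaf or end, so it is not evident that the prescriptions
  agree there. Instead of a case distinction on neighbours, the prescriptions are collected in a
  relation, which is monotone because the branches are matched in order. Each branch contributes at
  most one point to a section of it, and a tree with finitely many ends has only countably many
  branches, so the sections are countable.\<close>

lemma triple_homeo_exists:
  assumes t: "(T, U, \<phi>) \<in> tree_triples"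
  obtains h where "h \<in> carrier Homeo01" "strict_mono_on {0..1} h" "induces (T, U, \<phi>) h"
proof -
  have T: "full_binary_tree T" and U: "full_binary_tree U" and fin: "finite (ends T)"
    and bij: "bij_betw \<phi> (branches T) (branches U)"
    and order: "\<And>u v. u \<in> branches T \<Longrightarrow> v \<in> branches T \<Longrightarrow> left_of u v \<Longrightarrow> left_of (\<phi> u) (\<phi> v)"
    using t by (auto simp: tree_triples_def)
  have \<phi>: "\<phi> u \<in> branches U" if "u \<in> branches T" for u
    using bij that by (auto simp: bij_betw_def)
  note kind = triple_same_kind[OF t]
  \<comment> \<open>all pairs that the prescriptions on the cells force into the graph\<close>
  define G where "G = {(x, cell_map u (\<phi> u) x) | x u. u \<in> branches T \<and> x \<in> cell u}"
  have GI: "(x, cell_map u (\<phi> u) x) \<in> G" if "u \<in> branches T" "x \<in> cell u" for x u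
    using that by (auto simp: G_def)
  have image: "cell_map u (\<phi> u) x \<in> cell (\<phi> u)" if "u \<in> branches T" "x \<in> cell u" for x u
    using cell_map_image[OF kind[OF that(1)]] that(2) by blast
  obtain h where "h \<in> carrier Homeo01" "strict_mono_on {0..1} h"
    "\<And>x y. (x, y) \<in> G \<Longrightarrow> h x = y"
  proof (rule monotone_relation_homeo[of G])
    fix x y x' y' assume "(x, y) \<in> G" "(x', y') \<in> G" and less: "x < x'"
    then obtain u u' where u: "u \<in> branches T" "x \<in> cell u" "y = cell_map u (\<phi> u) x"
      and u': "u' \<in> branches T" "x' \<in> cell u'" "y' = cell_map u' (\<phi> u') x'"
      by (auto simp: G_def)
    show "y \<le> y'"
    proof (cases "u = u'")
      case True
      then have "y < y'"
        using strict_mono_onD[OF cell_map_strict_mono[OF kind[OF u(1)]] u(2) _ less] u u' by auto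
      then show ?thesis by simp
    next
      case False
      have "\<not> left_of u' u" using left_of_cells[OF _ u'(2) u(2)] less by auto
      then have "left_of (\<phi> u) (\<phi> u')"
        using left_of_total[OF T u(1) u'(1) False] order u(1) u'(1) by blast
      then show ?thesis
        using left_of_cells image u u' by metis
    qed
  next
    show "Domain G = {0..1}"
    proof
      show "Domain G \<subseteq> {0..1}" using cell_subset by (fastforce simp: G_def)
      show "{0..1} \<subseteq> Domain G"
      proof
        fix x :: real assume "x \<in> {0..1}"
        then obtain u where "u \<in> branches T" "x \<in> cell u" using branches_cover[OF T] by metis
        then show "x \<in> Domain G" using GI by blast
      qed
    qed
  next
    show "Range G = {0..1}"
    proof
      show "Range G \<subseteq> {0..1}" using cell_subset image by (fastforce simp: G_def)
      show "{0..1} \<subseteq> Range G"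
      proof
        fix y :: real assume "y \<in> {0..1}"
        then obtain v where v: "v \<in> branches U" "y \<in> cell v" using branches_cover[OF U] by metis
        then obtain u where u: "u \<in> branches T" "v = \<phi> u" using bij by (auto simp: bij_betw_def)
        then have "y \<in> cell_map u (\<phi> u) ` cell u"
          using cell_map_image[OF kind[OF u(1)]] v(2) by simp
        then show "y \<in> Range G" using GI u(1) by blast
      qed
    qed
  next
    fix x
    have "{y. (x, y) \<in> G} \<subseteq> (\<lambda>u. cell_map u (\<phi> u) x) ` branches T"
      by (auto simp: G_def)
    then show "countable {y. (x, y) \<in> G}"
      using countable_branches[OF fin] by (blast intro: countable_subset)
  next
    fix y
    have "{x. (x, y) \<in> G} \<subseteq> (\<lambda>u. inv_into (cell u) (cell_map u (\<phi> u)) y) ` branches T"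
    proof
      fix x assume "x \<in> {x. (x, y) \<in> G}"
      then obtain u where "u \<in> branches T" "x \<in> cell u" "y = cell_map u (\<phi> u) x"
        by (auto simp: G_def)
      then show "x \<in> (\<lambda>u. inv_into (cell u) (cell_map u (\<phi> u)) y) ` branches T"
        using inv_into_f_f[OF strict_mono_on_imp_inj_on[OF cell_map_strict_mono[OF kind]]]
        by (intro image_eqI[of _ _ u]) auto
    qed
    then show "countable {x. (x, y) \<in> G}"
      using countable_branches[OF fin] by (blast intro: countable_subset)
  qed blast
  then show ?thesis using that[of h] GI by (auto simp: induces_iff[OF t])
qed

lemma induces_unique:
  assumes t: "(T, U, \<phi>) \<in> tree_triples"
    and "h \<in> carrier Homeo01" "induces (T, U, \<phi>) h" "g \<in> carrier Homeo01" "induces (T, U, \<phi>) g"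
  shows "g = h"
proof (rule extensionalityI[of _ "{0..1}"])
  fix x :: real assume "x \<in> {0..1}"
  moreover have "full_binary_tree T" using t by (simp add: tree_triples_def)
  ultimately obtain u where "u \<in> branches T" "x \<in> cell u" using branches_cover by metis
  then show "g x = h x" using assms(3,5) by (simp add: induces_iff[OF t])
qed (use assms Homeo01_extensional in auto)

lemma triple_homeo_eq:
  assumes "t \<in> tree_triples" "h \<in> carrier Homeo01" "induces t h"
  shows "triple_homeo t = h"
  unfolding triple_homeo_def using assms induces_unique
  by (cases t) (intro the_equality; blast)

lemma triple_homeo:
  assumes "t \<in> tree_triples"
  shows "triple_homeo t \<in> carrier Homeo01" "strict_mono_on {0..1} (triple_homeo t)"
    "induces t (triple_homeo t)"
proof -
  obtain h where "h \<in> carrier Homeo01" "strict_mono_on {0..1} h" "induces t h"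
    using triple_homeo_exists assms by (metis surj_pair)
  moreover from this have "triple_homeo t = h" using triple_homeo_eq assms by blast
  ultimately show "triple_homeo t \<in> carrier Homeo01" "strict_mono_on {0..1} (triple_homeo t)"
    "induces t (triple_homeo t)" by auto
qed

text \<open>A leaf of the larger tree \<open>T'\<close> is \<open>p @ s\<close> for a leaf \<open>p\<close> of \<open>T\<close>, and it is matched with \<open>q @ s\<close>
  where \<open>q\<close> is matched with \<open>p\<close>. The affine map of \<open>[p]\<close> onto \<open>[q]\<close> replaces the prefix \<open>p\<close> of a binary
  expansion by \<open>q\<close>, hence maps \<open>[p @ s]\<close> affinely onto \<open>[q @ s]\<close>; the same holds for the new ends.\<close>

lemma caret_insertion_induces:
  assumes ins: "((T, U, \<phi>), (T', U', \<phi>')) \<in> caret_insertion" and h: "induces (T, U, \<phi>) h"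
  shows "induces (T', U', \<phi>') h"
proof -
  have t: "(T, U, \<phi>) \<in> tree_triples" and sub: "T \<subseteq> T'"
    and leaf: "\<And>p q s. p \<in> leaves T \<Longrightarrow> \<phi> (FinBr p) = FinBr q \<Longrightarrow> p @ s \<in> leaves T' \<Longrightarrow>
      \<phi>' (FinBr (p @ s)) = FinBr (q @ s)"
    and infinite: "\<And>p q w. p \<in> leaves T \<Longrightarrow> \<phi> (FinBr p) = FinBr q \<Longrightarrow> p @- w \<in> ends T' \<Longrightarrow>
      \<phi>' (InfBr (p @- w)) = InfBr (q @- w)"
    and old: "\<And>w. w \<in> ends T \<Longrightarrow> \<phi>' (InfBr w) = \<phi> (InfBr w)"
    and t': "(T', U', \<phi>') \<in> tree_triples"
    using ins by (auto simp: caret_insertion_def)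
  have T: "full_binary_tree T" using t by (simp add: tree_triples_def)
  have affine: "h x = lo q + 2 ^ length p / 2 ^ length q * (x - lo p)"
    if "p \<in> leaves T" "\<phi> (FinBr p) = FinBr q" "x \<in> {lo p..hi p}" for p q x
    using that h unfolding cell_map_FinBr[symmetric] by (simp add: induces_def)
  have "h x = cell_map (FinBr p') (\<phi>' (FinBr p')) x" 
    if p': "p' \<in> leaves T'" and x: "x \<in> {lo p'..hi p'}" for p' x
  proof -
    define n where "n = Suc (length p')"
    \<comment> \<open>any stream through \<open>p'\<close> would do; it leaves \<open>T\<close> at the latest one step below \<open>p'\<close>\<close>
    have "stake n (p' @- sconst False) = p' @ [False]" by (simp add: n_def stake_shift)
    moreover have "p' @ [False] \<notin> T" using p' sub by (auto simp: leaves_def)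
    ultimately obtain k where k: "stake k (p' @- sconst False) \<in> leaves T" "k < n"
      using stream_follows_branch[OF T] by metis
    define p s where "p = take k p'" and "s = drop k p'"
    have p: "p \<in> leaves T" and p's: "p' = p @ s" using k by (auto simp: p_def s_def n_def stake_shift)
    obtain q where q: "\<phi> (FinBr p) = FinBr q" using triple_leaf[OF t p] .
    have "lo p \<le> lo p'" "hi p' \<le> hi p"
      using lo_hi_bounds[of s] by (simp_all add: p's lo_append hi_append hi_eq[of p] divide_right_mono)
    then have "h x = lo q + 2 ^ length p / 2 ^ length q * (x - lo p)"
      using affine p q x by simp
    also have "\<dots> = cell_map (FinBr p') (FinBr (q @ s)) x"
      unfolding cell_map_FinBr by (simp add: p's lo_append power_add field_simps)
    finally show ?thesis using leaf[OF p q] p' p's by simp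
  qed
  moreover have "h (binval w) = cell_map (InfBr w) (\<phi>' (InfBr w)) (binval w)"
    if w: "w \<in> ends T'" for w
  proof (rule ends_subtree_cases[OF T, of w])
    assume "w \<in> ends T"
    then show ?thesis
      using h old[of w] unfolding induces_iff[OF t] by (auto simp: branches_def)
  next
    fix p v assume p: "p \<in> leaves T" and wv: "w = p @- v"
    obtain q where q: "\<phi> (FinBr p) = FinBr q" using triple_leaf[OF t p] .
    have "h (binval w) = lo q + 2 ^ length p / 2 ^ length q * (binval w - lo p)"
      using binval_bounds[of v] by (intro affine p q) (simp add: wv binval_shift hi_eq divide_right_mono)
    also have "\<dots> = binval (q @- v)" by (simp add: wv binval_shift)
    finally show ?thesis using infinite[OF p q] w wv by simp
  qed
  ultimately show ?thesis unfolding induces_iff[OF t'] by (auto simp: branches_def simp del: cell_map.simps)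
qed

lemma triple_homeo_invariant:
  assumes "(t, t') \<in> (caret_insertion \<union> caret_insertion\<inverse>)\<^sup>*"
  shows "triple_homeo t' = triple_homeo t"
  using assms
proof (induction rule: rtrancl_induct)
  case (step s s')
  have "triple_homeo s' = triple_homeo s" if "(s, s') \<in> caret_insertion" for s s'
  proof (rule triple_homeo_eq)
    have "s \<in> tree_triples" using that by (auto simp: caret_insertion_def)
    then show "triple_homeo s \<in> carrier Homeo01" "induces s' (triple_homeo s)"
      using triple_homeo[of s] caret_insertion_induces that by (auto, (cases s; cases s'; simp; blast)?)
    show "s' \<in> tree_triples" using that by (auto simp: caret_insertion_def)
  qed
  then show ?case using step by fastforce
qed simp

lemma tree_F_homeo_triple:
  assumes "C \<in> tree_F"
  obtains t where "t \<in> tree_triples" "tree_F_homeo C = triple_homeo t"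
proof -
  obtain t where t: "t \<in> tree_triples" "C = (caret_insertion \<union> caret_insertion\<inverse>)\<^sup>* `` {t}"
    using assms by (auto simp: tree_F_def elim: quotientE)
  then have "triple_homeo ` C = {triple_homeo t}"
    using triple_homeo_invariant by fastforce
  then show ?thesis using that t by (simp add: tree_F_homeo_def)
qed

section \<open>Interpolation by dyadic piecewise-linear maps\<close>

lemma dyadic_of_int: "of_int m \<in> dyadic"
proof -
  have "of_int m = (of_int m / 2 ^ 0 :: real)" by simp
  then show ?thesis unfolding dyadic_def by blast
qed

lemma dyadic_add:
  assumes "x \<in> dyadic" "y \<in> dyadic"
  shows "x + y \<in> dyadic"
proof -
  obtain m n m' n' where xy: "x = of_int m / 2 ^ n" "y = of_int m' / 2 ^ n'"
    using assms by (auto simp: dyadic_def)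
  have "x + y = of_int (m * 2 ^ n' + m' * 2 ^ n) / 2 ^ (n + n')"
    unfolding xy by (simp add: power_add field_simps)
  then show ?thesis unfolding dyadic_def by blast
qed

lemma dyadic_mult:
  assumes "x \<in> dyadic" "y \<in> dyadic"
  shows "x * y \<in> dyadic"
proof -
  obtain m n m' n' where xy: "x = of_int m / 2 ^ n" "y = of_int m' / 2 ^ n'"
    using assms by (auto simp: dyadic_def)
  have "x * y = of_int (m * m') / 2 ^ (n + n')"
    unfolding xy by (simp add: power_add)
  then show ?thesis unfolding dyadic_def by blast
qed

lemma dyadic_diff: "x \<in> dyadic \<Longrightarrow> y \<in> dyadic \<Longrightarrow> x - y \<in> dyadic"
  using dyadic_add[of x "of_int (- 1) * y"] dyadic_mult dyadic_of_int by fastforce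

lemma dyadic_power_int: "2 powi k \<in> dyadic"
proof (cases "k \<ge> 0")
  case True
  then have "2 powi k = (of_int (2 ^ nat k) :: real)" by (simp add: power_int_def)
  then show ?thesis using dyadic_of_int by metis
next
  case False
  then have "2 powi k = (of_int 1 / 2 ^ nat (- k) :: real)"
    by (simp add: power_int_def power_one_over inverse_eq_divide)
  then show ?thesis unfolding dyadic_def by blast
qed

text \<open>The condition on subdivision points is the one in \<^const>\<open>thompson_F\<close>, relative to the interval
  \<open>[a,b]\<close>. The condition on the image expresses continuity in a form that is inherited by
  concatenations. Degenerate intervals \<open>a = b\<close> are included, so that pieces of length \<open>0\<close> need no
  special treatment.\<close>

definition dyadic_PL :: "real \<Rightarrow> real \<Rightarrow> (real \<Rightarrow> real) \<Rightarrow> bool" where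
  "dyadic_PL a b f \<longleftrightarrow> strict_mono_on {a..b} f \<and> f ` {a..b} = {f a..f b} \<and>
     (\<exists>B. finite B \<and> {a, b} \<subseteq> B \<and> B \<subseteq> dyadic \<inter> {a..b} \<and>
       (\<forall>x\<in>B. \<forall>y\<in>B. x < y \<and> {x<..<y} \<inter> B = {} \<longrightarrow>
         (\<exists>k :: int. \<forall>z\<in>{x..y}. f z = f x + 2 powi k * (z - x))))"

lemma dyadic_PL_cong:
  assumes "dyadic_PL a b f" "\<And>x. x \<in> {a..b} \<Longrightarrow> f x = g x"
  shows "dyadic_PL a b g"
proof -
  obtain B where B: "finite B" "{a, b} \<subseteq> B" "B \<subseteq> dyadic \<inter> {a..b}"
    "\<forall>x\<in>B. \<forall>y\<in>B. x < y \<and> {x<..<y} \<inter> B = {} \<longrightarrow>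
      (\<exists>k :: int. \<forall>z\<in>{x..y}. f z = f x + 2 powi k * (z - x))"
    using assms(1) unfolding dyadic_PL_def by blast
  have "\<exists>k :: int. \<forall>z\<in>{x..y}. g z = g x + 2 powi k * (z - x)"
    if xy: "x \<in> B" "y \<in> B" "x < y" "{x<..<y} \<inter> B = {}" for x y
  proof -
    have "{x..y} \<subseteq> {a..b}" using B(3) xy by auto
    then have "g z = f z" if "z \<in> {x..y}" for z using assms(2)[of z] that by auto
    moreover have "x \<in> {x..y}" using xy by simp
    ultimately show ?thesis using B(4) xy by metis
  qed
  moreover have "strict_mono_on {a..b} g"
    using assms by (auto simp: dyadic_PL_def strict_mono_on_def)
  moreover have "g ` {a..b} = f ` {a..b}"
    using assms(2) by (intro image_cong) auto
  then have "g ` {a..b} = {g a..g b}"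
    using assms B(2,3) by (auto simp: dyadic_PL_def)
  ultimately show ?thesis using B(1-3) unfolding dyadic_PL_def by blast
qed

lemma dyadic_PL_affine:
  assumes "a \<in> dyadic" "b \<in> dyadic" "a \<le> b"
    and f: "\<And>x. x \<in> {a..b} \<Longrightarrow> f x = c + 2 powi k * (x - a)"
  shows "dyadic_PL a b f"
proof -
  define g where "g = (\<lambda>x. c + 2 powi k * (x - a))"
  have pos: "(0::real) < 2 powi k" by simp
  have "strict_mono_on {a..b} g" by (simp add: strict_mono_on_def g_def)
  moreover have "g ` {a..b} = {g a..g b}"
  proof
    show "g ` {a..b} \<subseteq> {g a..g b}" by (auto simp: g_def)
    show "{g a..g b} \<subseteq> g ` {a..b}"
    proof
      fix y assume y: "y \<in> {g a..g b}"
      then have "(y - c) / 2 powi k \<in> {0..b - a}"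
        using pos by (simp add: g_def pos_divide_le_eq mult.commute)
      moreover have "y = g (a + (y - c) / 2 powi k)" using pos by (simp add: g_def)
      ultimately show "y \<in> g ` {a..b}" by (intro image_eqI[of _ _ "a + (y - c) / 2 powi k"]) auto
    qed
  qed
  moreover have "\<exists>k :: int. \<forall>z\<in>{x..y}. g z = g x + 2 powi k * (z - x)" for x y
    by (intro exI[of _ k]) (simp add: g_def algebra_simps)
  ultimately have "dyadic_PL a b g"
    using assms(1-3) unfolding dyadic_PL_def by (intro conjI exI[of _ "{a, b}"]) auto
  then show ?thesis by (rule dyadic_PL_cong) (simp add: f g_def)
qed

lemma dyadic_PL_concat:
  assumes f: "dyadic_PL a b f" "dyadic_PL b c f"
  shows "dyadic_PL a c f"
proof -
  obtain B where B: "finite B" "{a, b} \<subseteq> B" "B \<subseteq> dyadic \<inter> {a..b}"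
    "\<forall>x\<in>B. \<forall>y\<in>B. x < y \<and> {x<..<y} \<inter> B = {} \<longrightarrow>
      (\<exists>k :: int. \<forall>z\<in>{x..y}. f z = f x + 2 powi k * (z - x))"
    using f(1) unfolding dyadic_PL_def by blast
  obtain C where C: "finite C" "{b, c} \<subseteq> C" "C \<subseteq> dyadic \<inter> {b..c}"
    "\<forall>x\<in>C. \<forall>y\<in>C. x < y \<and> {x<..<y} \<inter> C = {} \<longrightarrow>
      (\<exists>k :: int. \<forall>z\<in>{x..y}. f z = f x + 2 powi k * (z - x))"
    using f(2) unfolding dyadic_PL_def by blast
  have abc: "a \<le> b" "b \<le> c" using B(2,3) C(2,3) by auto
  have mono: "strict_mono_on {a..b} f" "strict_mono_on {b..c} f"
    and image: "f ` {a..b} = {f a..f b}" "f ` {b..c} = {f b..f c}"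
    using f by (auto simp: dyadic_PL_def)
  have le: "f a \<le> f b" "f b \<le> f c"
    using strict_mono_on_leD[OF mono(1), of a b] strict_mono_on_leD[OF mono(2), of b c] abc by auto
  have mono_ac: "strict_mono_on {a..c} f"
  proof (rule strict_mono_onI)
    fix x y assume xy: "x \<in> {a..c}" "y \<in> {a..c}" "x < y"
    show "f x < f y"
    proof (cases "y \<le> b \<or> b \<le> x")
      case True
      then show ?thesis
        using strict_mono_onD[OF mono(1), of x y] strict_mono_onD[OF mono(2), of x y] xy by auto
    next
      case False
      then show ?thesis
        using strict_mono_onD[OF mono(1), of x b] strict_mono_onD[OF mono(2), of b y] xy abc by auto
    qed
  qed
  have image_ac: "f ` {a..c} = {f a..f c}"
  proof -
    have "{a..c} = {a..b} \<union> {b..c}" "{f a..f c} = {f a..f b} \<union> {f b..f c}"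
      using abc le by auto
    then show ?thesis by (metis image image_Un)
  qed
  have pieces: "\<exists>k :: int. \<forall>z\<in>{x..y}. f z = f x + 2 powi k * (z - x)"
    if xy: "x \<in> B \<union> C" "y \<in> B \<union> C" "x < y" "{x<..<y} \<inter> (B \<union> C) = {}" for x y
  proof -
    have "\<not> (x < b \<and> b < y)" using xy(4) B(2) by auto
    then consider "y \<le> b" | "b \<le> x" by linarith
    then show ?thesis
    proof cases
      case 1
      then have "x \<in> B" "y \<in> B" using xy B(2) C(3) by force+
      then show ?thesis using B(4) xy by blast
    next
      case 2
      then have "x \<in> C" "y \<in> C" using xy C(2) B(3) by force+
      then show ?thesis using C(4) xy by blast
    qed
  qed
  have nodes: "finite (B \<union> C)" "{a, c} \<subseteq> B \<union> C" "B \<union> C \<subseteq> dyadic \<inter> {a..c}"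
    using B(1-3) C(1-3) abc by auto
  show ?thesis
    unfolding dyadic_PL_def
    by (intro conjI exI[of _ "B \<union> C"] ballI impI mono_ac image_ac nodes; elim conjE; rule pieces)
qed

text \<open>Uniqueness of \<open>k\<close> among the exponents with \<open>r = 2\<^sup>k\<close> is what later recovers an affine map of
  slope \<open>2\<^sup>k\<close> exactly.\<close>

lemma floor_log2_unique:
  fixes r :: real
  assumes "0 < r"
  obtains k :: int where "2 powi k \<le> r" "r < 2 powi (k + 1)"
    "\<And>j :: int. r = 2 powi j \<Longrightarrow> j = k"
proof
  have powr: "2 powr of_int k = (2 :: real) powi k" for k :: int
    by (simp add: powr_real_of_int')
  let ?k = "\<lfloor>log 2 r\<rfloor>"
  show "2 powi ?k \<le> r" "r < 2 powi (?k + 1)"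
    using floor_log_eq_powr_iff[OF assms, of 2 ?k] powr[of ?k] powr[of "?k + 1"] by auto
  show "j = ?k" if "r = 2 powi j" for j :: int
    unfolding that powr[symmetric] by simp
qed

text \<open>Write \<open>L\<close>, \<open>M\<close> for the lengths of the two intervals and choose \<open>k\<close> with
  \<open>2\<^sup>k L \<le> M < 2\<^sup>k\<^sup>+\<^sup>1 L\<close>. Slope \<open>2\<^sup>k\<^sup>+\<^sup>1\<close> on an initial piece of length \<open>t\<close> and slope \<open>2\<^sup>k\<close> on the rest
  gives total rise \<open>2\<^sup>k (L + t)\<close>, so \<open>t = M / 2\<^sup>k - L\<close>, which is dyadic and lies in \<open>[0,L)\<close>.
  When \<open>M = 2\<^sup>k L\<close> there is no initial piece and the map is affine.\<close>

lemma dyadic_PL_between: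
  assumes dy: "a \<in> dyadic" "b \<in> dyadic" "c \<in> dyadic" "d \<in> dyadic" and "a < b" "c < d"
  obtains g where "dyadic_PL a b g" "g a = c" "g b = d"
    "\<And>k :: int. d - c = 2 powi k * (b - a) \<Longrightarrow> \<forall>x\<in>{a..b}. g x = c + 2 powi k * (x - a)"
proof -
  have "0 < (d - c) / (b - a)" using assms by simp
  then obtain k :: int where k: "2 powi k \<le> (d - c) / (b - a)" "(d - c) / (b - a) < 2 powi (k + 1)"
    and unique: "\<And>j :: int. (d - c) / (b - a) = 2 powi j \<Longrightarrow> j = k"
    by (rule floor_log2_unique) blast
  define s :: real where "s = 2 powi k"
  have s: "0 < s" "2 powi (k + 1) = 2 * s" by (simp_all add: s_def power_int_add)
  define m where "m = a + ((d - c) / s - (b - a))"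
  have "s * (b - a) \<le> d - c" "d - c < 2 * s * (b - a)"
    using k \<open>a < b\<close> unfolding s(2) s_def[symmetric] by (simp_all add: field_simps)
  then have m: "a \<le> m" "m < b"
    using s(1) by (simp_all add: m_def field_simps)
  have "(d - c) / s = (d - c) * 2 powi (- k)" by (simp add: s_def power_int_minus divide_inverse)
  then have "m \<in> dyadic"
    by (simp only: m_def) (intro dyadic_add dyadic_diff dyadic_mult dyadic_power_int dy)
  have "m - a = (d - c) / s - (b - a)" by (simp add: m_def)
  then have "s * (m - a) = (d - c) - s * (b - a)"
    using s(1) by (simp only: right_diff_distrib[of s "(d - c) / s"]) simp
  moreover have "s * (b - m) = s * (b - a) - s * (m - a)" "2 * s * (m - a) = 2 * (s * (m - a))"
    by (simp_all add: right_diff_distrib)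
  ultimately have at_m: "c + 2 * s * (m - a) = d - s * (b - m)" by linarith
  define g where "g = (\<lambda>x. if x \<le> m then c + 2 * s * (x - a) else d - s * (b - x))"
  \<comment> \<open>the two formulas agree at the break point \<open>m\<close>\<close>
  have right: "g x = d - s * (b - x)" if "m \<le> x" for x
  proof (cases "x = m")
    case True
    then show ?thesis using at_m by (simp add: g_def)
  qed (use that in \<open>simp add: g_def\<close>)
  have "dyadic_PL a m g"
    using \<open>m \<in> dyadic\<close> dy m
    by (intro dyadic_PL_affine[where c = c and k = "k + 1"]) (simp_all add: g_def s(2))
  moreover have "dyadic_PL m b g"
    using \<open>m \<in> dyadic\<close> dy m right
    by (intro dyadic_PL_affine[where c = "d - s * (b - m)" and k = k])
      (simp_all add: s_def[symmetric] algebra_simps)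
  ultimately have "dyadic_PL a b g" by (rule dyadic_PL_concat)
  moreover have "g a = c" "g b = d" using m by (simp_all add: g_def)
  moreover have "\<forall>x\<in>{a..b}. g x = c + 2 powi j * (x - a)" if j: "d - c = 2 powi j * (b - a)" for j :: int
  proof -
    have "j = k" using unique[of j] j \<open>a < b\<close> by simp
    then have d: "d = c + s * (b - a)" using j by (simp add: s_def)
    then have "m = a" using s(1) by (simp add: m_def)
    then show ?thesis using right d \<open>j = k\<close> by (simp add: s_def[symmetric] algebra_simps)
  qed
  ultimately show ?thesis using that by blast
qed

text \<open>The interpolation uses the map of the preceding lemma between neighbouring nodes. The last
  clause needs no information on which nodes are neighbours: if \<open>h\<close> is affine with slope a power
  of two between two nodes, it is so between all nodes in between, and there the interpolating
  pieces coincide with \<open>h\<close>. The induction adds a new rightmost node.\<close>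

lemma dyadic_PL_interpolation:
  fixes h :: "real \<Rightarrow> real"
  assumes "finite M" "M \<subseteq> {a<..}" "insert a M \<subseteq> dyadic" "h ` insert a M \<subseteq> dyadic"
    "strict_mono_on (insert a M) h"
  shows "\<exists>f. dyadic_PL a (Max (insert a M)) f \<and> (\<forall>x\<in>insert a M. f x = h x) \<and>
    (\<forall>x\<in>insert a M. \<forall>y\<in>insert a M. \<forall>k :: int. x < y \<longrightarrow>
      (\<forall>z\<in>{x..y}. h z = h x + 2 powi k * (z - x)) \<longrightarrow> (\<forall>z\<in>{x..y}. f z = h z))"
  using assms
proof (induction M rule: finite_linorder_max_induct)
  case empty
  have "dyadic_PL a a h"
  proof (rule dyadic_PL_affine[where c = "h a" and k = 0])
    show "a \<in> dyadic" using empty.prems(2) by simp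
    then show "a \<in> dyadic" .
    show "h x = h a + 2 powi 0 * (x - a)" if "x \<in> {a..a}" for x using that by simp
  qed simp
  then show ?case by (intro exI[of _ h]) simp
next
  case (insert m M)
  have "strict_mono_on (insert a M) h"
    using insert.prems(4) by (auto simp: strict_mono_on_def)
  moreover have "M \<subseteq> {a<..}" "insert a M \<subseteq> dyadic" "h ` insert a M \<subseteq> dyadic"
    using insert.prems(1-3) by auto
  ultimately obtain f where f: "dyadic_PL a (Max (insert a M)) f" "\<forall>x\<in>insert a M. f x = h x"
    and eq: "\<forall>x\<in>insert a M. \<forall>y\<in>insert a M. \<forall>k :: int. x < y \<longrightarrow>
      (\<forall>z\<in>{x..y}. h z = h x + 2 powi k * (z - x)) \<longrightarrow> (\<forall>z\<in>{x..y}. f z = h z)"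
    using insert.IH by blast
  have f_eq: "f z = h z" if "x \<in> insert a M" "y \<in> insert a M" "x < y"
    "\<forall>z\<in>{x..y}. h z = h x + 2 powi k * (z - x)" "z \<in> {x..y}" for x y z and k :: int
    using eq that by blast
  define b where "b = Max (insert a M)"
  have b: "b \<in> insert a M" "\<And>x. x \<in> insert a M \<Longrightarrow> x \<le> b"
    using \<open>finite M\<close> Max_in[of "insert a M"] by (auto simp: b_def)
  have "b < m" using b(1) insert.hyps(2) insert.prems(1) by auto
  have "h b < h m"
    using strict_mono_onD[OF insert.prems(4), of b m] b(1) \<open>b < m\<close> by auto
  have dyadic: "b \<in> dyadic" "m \<in> dyadic" "h b \<in> dyadic" "h m \<in> dyadic"
    using b(1) insert.prems(2,3) by auto
  obtain g where g: "dyadic_PL b m g" "g b = h b" "g m = h m"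
    and g_eq: "\<And>k :: int. h m - h b = 2 powi k * (m - b) \<Longrightarrow> \<forall>x\<in>{b..m}. g x = h b + 2 powi k * (x - b)"
    using dyadic_PL_between[OF dyadic \<open>b < m\<close> \<open>h b < h m\<close>] by blast
  define F where "F = (\<lambda>x. if x \<le> b then f x else g x)"
  have F: "F x = f x" if "x \<le> b" for x using that by (simp add: F_def)
  have G: "F x = g x" if "b \<le> x" for x using that f(2) b(1) g(2) by (auto simp: F_def)
  have "dyadic_PL a b F" using f(1) unfolding b_def[symmetric] by (rule dyadic_PL_cong) (simp add: F)
  moreover have "dyadic_PL b m F" using g(1) by (rule dyadic_PL_cong) (simp add: G)
  ultimately have PL: "dyadic_PL a m F" by (rule dyadic_PL_concat)
  have Max: "Max (insert a (insert m M)) = m"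
    using b \<open>b < m\<close> \<open>finite M\<close> by (intro Max_eqI) (auto intro: order_trans less_imp_le)
  have node: "F x = h x" if "x \<in> insert a (insert m M)" for x
    using that F[of x] G[of m] f(2) b(2)[of x] g(3) \<open>b < m\<close> by (cases "x = m") auto
  have affine: "F z = h z"
    if xy: "x \<in> insert a (insert m M)" "y \<in> insert a (insert m M)" "x < y"
      and h: "\<forall>z\<in>{x..y}. h z = h x + 2 powi k * (z - x)" and z: "z \<in> {x..y}" for x y z and k :: int
  proof -
    have x: "x \<in> insert a M" using xy b \<open>b < m\<close> by force
    show ?thesis
    proof (cases "y = m")
      case False
      then have "y \<in> insert a M" using xy by auto
      then show ?thesis using f_eq[OF x _ xy(3) h z] F[of z] b(2)[of y] z by auto
    next
      case True
      have xb: "x \<le> b" using b(2) x by simp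
      have at: "h u = h x + 2 powi k * (u - x)" if "x \<le> u" "u \<le> m" for u
        using bspec[OF h, of u] that \<open>y = m\<close> by simp
      show ?thesis
      proof (cases "z \<le> b")
        case zb: True
        show ?thesis
        proof (cases "x = b")
          case True
          then show ?thesis using zb z F[of z] f(2) b(1) by auto
        next
          case False
          then have "x < b" using xb by simp
          moreover have "\<forall>z\<in>{x..b}. h z = h x + 2 powi k * (z - x)"
            using \<open>b < m\<close> by (intro ballI at) auto
          moreover have "z \<in> {x..b}" using z zb by simp
          ultimately have "f z = h z" by (rule f_eq[OF x b(1)])
          then show ?thesis using F[OF zb] by simp
        qed
      next
        case False
        have from_b: "h u = h b + 2 powi k * (u - b)" if "u \<in> {b..m}" for u
        proof -
          have hb: "h b = h x + 2 powi k * (b - x)" using xb \<open>b < m\<close> by (intro at) auto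
          have hu: "h u = h x + 2 powi k * (u - x)" using xb that by (intro at) auto
          show ?thesis unfolding hu hb by (simp add: right_diff_distrib)
        qed
        have "h m - h b = 2 powi k * (m - b)"
          using from_b[of m] \<open>b < m\<close> by simp
        then have "g z = h b + 2 powi k * (z - b)" using g_eq z False \<open>y = m\<close> by simp
        also have "\<dots> = h z" using from_b[of z] z False \<open>y = m\<close> by simp
        finally show ?thesis using G False by simp
      qed
    qed
  qed
  show ?case unfolding Max using PL node affine by blast
qed

section \<open>Hamming limits of elements of Thompson's group\<close>

lemma thompson_F_Homeo01: "f \<in> thompson_F \<Longrightarrow> f \<in> carrier Homeo01"
  and thompson_F_strict_mono: "f \<in> thompson_F \<Longrightarrow> strict_mono_on {0..1} f"
  by (auto simp: thompson_F_def)

lemma dyadic_PL_thompson_F: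
  assumes f: "dyadic_PL 0 1 f" "f 0 = 0" "f 1 = 1"
  shows "restrict f {0..1} \<in> thompson_F"
proof -
  define g where "g = restrict f {0..1}"
  have g: "dyadic_PL 0 1 g" using f(1) by (rule dyadic_PL_cong) (simp add: g_def)
  then have mono: "strict_mono_on {0..1} g" by (simp add: dyadic_PL_def)
  have "g ` {0..1} = {0..1}" using g f(2,3) by (simp add: dyadic_PL_def g_def)
  then have "g \<in> carrier Homeo01"
    using mono by (intro increasing_bijection_Homeo01) (auto simp: g_def)
  moreover obtain B where "finite B" "{0, 1} \<subseteq> B" "B \<subseteq> dyadic \<inter> {0..1}"
    "\<forall>x\<in>B. \<forall>y\<in>B. x < y \<and> {x<..<y} \<inter> B = {} \<longrightarrow>
      (\<exists>k :: int. \<forall>z\<in>{x..y}. g z = g x + 2 powi k * (z - x))"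
    using g unfolding dyadic_PL_def by blast
  ultimately show ?thesis
    using mono unfolding thompson_F_def g_def[symmetric] mem_Collect_eq by blast
qed

lemma Homeo01_inv_into:
  assumes "f \<in> carrier Homeo01" "y \<in> {0..1}"
  shows "inv_into {0..1} f y \<in> {0..1}" "f (inv_into {0..1} f y) = y"
  using bij_betw_imp_surj_on[OF Homeo01_bij[OF assms(1)]] assms(2)
  by (metis inv_into_into, metis f_inv_into_f)

lemma inv_differs_lmeasurable:
  assumes "f \<in> carrier Homeo01" "g \<in> carrier Homeo01"
  shows "{y \<in> {0..1}. inv_into {0..1} f y \<noteq> inv_into {0..1} g y} \<in> lmeasurable"
  using assms by (intro differ_lmeasurable Homeo01_continuous)

text \<open>If \<open>f x < g x\<close>, then for \<open>y\<close> strictly between the two values \<open>f\<^sup>-\<^sup>1 y > x > g\<^sup>-\<^sup>1 y\<close>, so the inverses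
  differ on an interval of length \<open>g x - f x\<close>. Thus the Hamming metric dominates the uniform metric
  on increasing homeomorphisms, thanks to its second summand.\<close>

lemma hamming_dist_bound:
  assumes f: "f \<in> carrier Homeo01" "strict_mono_on {0..1} f"
    and g: "g \<in> carrier Homeo01" "strict_mono_on {0..1} g" and x: "x \<in> {0..1}"
  shows "\<bar>f x - g x\<bar> \<le> hamming_dist f g"
proof -
  have bound: "g x - f x \<le> hamming_dist f g"
    if f: "f \<in> carrier Homeo01" "strict_mono_on {0..1} f"
      and g: "g \<in> carrier Homeo01" "strict_mono_on {0..1} g" and "f x \<le> g x" for f g
  proof -
    let ?D = "{y \<in> {0..1}. inv_into {0..1} f y \<noteq> inv_into {0..1} g y}"
    have unit: "f x \<in> {0..1}" "g x \<in> {0..1}"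
      using Homeo01_bij f(1) g(1) x bij_betwE by blast+
    have "{f x<..<g x} \<subseteq> ?D"
    proof
      fix y assume y: "y \<in> {f x<..<g x}"
      then have y01: "y \<in> {0..1}" using unit by auto
      define u v where "u = inv_into {0..1} f y" and "v = inv_into {0..1} g y"
      have u: "u \<in> {0..1}" "f u = y" and v: "v \<in> {0..1}" "g v = y"
        using Homeo01_inv_into f(1) g(1) y01 by (auto simp: u_def v_def)
      have "\<not> u \<le> x" using strict_mono_on_leD[OF f(2) u(1) x] u(2) y by auto
      moreover have "\<not> x \<le> v" using strict_mono_on_leD[OF g(2) x v(1)] v(2) y by auto
      ultimately show "y \<in> ?D" using y01 by (auto simp: u_def v_def)
    qed
    then have "measure lebesgue {f x<..<g x} \<le> measure lebesgue ?D"
      using inv_differs_lmeasurable[OF f(1) g(1)] by (intro measure_mono_fmeasurable) auto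
    then have "g x - f x \<le> measure lebesgue ?D" using that(5) by simp
    then show ?thesis unfolding hamming_dist_def by (smt (verit) measure_nonneg)
  qed
  have "hamming_dist f g = hamming_dist g f" by (simp add: hamming_dist_def eq_commute)
  then show ?thesis
    using bound[OF f g] bound[OF g f] by (cases "f x \<le> g x") auto
qed

text \<open>An approximating sequence is Cauchy by the triangle inequality. Since Hamming convergence
  implies uniform convergence, every sequence equivalent to it also has \<open>h\<close> as its pointwise limit,
  so that the value of \<^const>\<open>F_bar_homeo\<close> on the class is well defined and equal to \<open>h\<close>.\<close>

lemma hamming_limit_in_F_bar:
  assumes h: "h \<in> carrier Homeo01" "strict_mono_on {0..1} h"
    and approx: "\<And>e. e > 0 \<Longrightarrow> \<exists>f\<in>thompson_F. hamming_dist f h < e"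
  shows "h \<in> F_bar_homeo ` carrier F_bar"
proof -
  interpret Metric_space "carrier Homeo01" hamming_dist by (rule Metric_space_Homeo01)
  note F = thompson_F_Homeo01 thompson_F_strict_mono
  obtain s where s: "s n \<in> thompson_F" "hamming_dist (s n) h < 1 / Suc n" for n
    using approx[of "1 / Suc _"] by (metis of_nat_0_less_iff zero_less_Suc zero_less_divide_1_iff)
  have harmonic: "(\<lambda>n. 1 / real (Suc n)) \<longlonglongrightarrow> 0"
    using LIMSEQ_inverse_real_of_nat by (simp add: inverse_eq_divide)
  have lim: "(\<lambda>n. hamming_dist (s n) h) \<longlonglongrightarrow> 0"
    by (rule real_tendsto_sandwich[OF _ _ tendsto_const harmonic])
      (intro always_eventually allI nonneg less_imp_le[OF s(2)])+
  have "s \<in> F_cauchy"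
    unfolding F_cauchy_iff
  proof (intro conjI allI impI)
    show "range s \<subseteq> thompson_F" using s(1) by blast
    fix e :: real assume "e > 0"
    then obtain N where N: "hamming_dist (s n) h < e / 2" if "n \<ge> N" for n
      using order_tendstoD(2)[OF lim, of "e / 2"] by (auto simp: eventually_sequentially)
    have "hamming_dist (s n) (s n') < e" if "N \<le> n" "N \<le> n'" for n n'
      using N[OF that(1)] N[OF that(2)] triangle[of "s n" h "s n'"] F(1)[OF s(1)] h(1)
        commute[of h "s n'"] by auto
    then show "\<exists>N. \<forall>n n'. N \<le> n \<longrightarrow> N \<le> n' \<longrightarrow> hamming_dist (s n) (s n') < e" by blast
  qed
  define C where "C = F_cauchy_rel `` {s}"
  have "C \<in> carrier F_bar"
    using \<open>s \<in> F_cauchy\<close> by (simp add: F_bar_def C_def quotientI)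
  have "pointwise_lim r = h" if "r \<in> C" for r
  proof (rule extensionalityI[of _ "{0..1}"])
    have r: "r \<in> F_cauchy" "(\<lambda>n. hamming_dist (s n) (r n)) \<longlonglongrightarrow> 0"
      using that by (auto simp: C_def F_cauchy_rel_def)
    have rF: "r n \<in> thompson_F" for n using r(1) by (auto simp: F_cauchy_iff)
    fix x :: real assume x: "x \<in> {0..1}"
    have "(\<lambda>n. r n x) \<longlonglongrightarrow> h x"
    proof -
      have bound: "\<bar>r n x - h x\<bar> \<le> hamming_dist (s n) (r n) + hamming_dist (s n) h" for n
        using hamming_dist_bound[OF F[OF rF] h x, of n] triangle[of "r n" "s n" h]
          commute[of "r n" "s n"] F(1)[OF rF] F(1)[OF s(1)] h(1) by fastforce
      have sum: "(\<lambda>n. hamming_dist (s n) (r n) + hamming_dist (s n) h) \<longlonglongrightarrow> 0"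
        using tendsto_add[OF r(2) lim] by simp
      have "(\<lambda>n. r n x - h x) \<longlonglongrightarrow> 0"
        by (rule Lim_null_comparison[OF always_eventually sum]) (simp only: real_norm_def bound simp_thms)
      then show ?thesis by (simp add: LIM_zero_iff)
    qed
    then show "pointwise_lim r x = h x" using x by (simp add: pointwise_lim_def limI)
  qed (use Homeo01_extensional[OF h(1)] in \<open>auto simp: pointwise_lim_def\<close>)
  moreover have "s \<in> C"
    using \<open>s \<in> F_cauchy\<close> by (simp add: C_def F_cauchy_rel_def hamming_dist_def)
  ultimately have "pointwise_lim ` C = {h}" by blast
  then have "F_bar_homeo C = h" by (simp add: F_bar_homeo_def)
  then show ?thesis using \<open>C \<in> carrier F_bar\<close> by blast
qed

section \<open>Approximation of tree homeomorphisms\<close>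

text \<open>Continuity of the measure from above; what remains uncovered in the limit is finite, hence
  null.\<close>

lemma uncovered_measure_tendsto_0:
  fixes K :: "nat \<Rightarrow> real set"
  assumes "incseq K" "\<And>n. compact (K n)" "finite ({0..1} - (\<Union>n. K n))"
  shows "(\<lambda>n. measure lebesgue ({0..1} - K n)) \<longlonglongrightarrow> 0"
proof -
  have meas: "{0..1} - K n \<in> lmeasurable" for n
    using lmeasurable_compact[OF assms(2)[of n]] by (intro fmeasurable.Diff) auto
  have "(\<lambda>n. measure lebesgue ({0..1} - K n)) \<longlonglongrightarrow> measure lebesgue (\<Inter>n. {0..1} - K n)"
  proof (rule Lim_measure_decseq)
    show "range (\<lambda>n. {0..1} - K n) \<subseteq> sets lebesgue" using meas by blast
    show "decseq (\<lambda>n. {0..1} - K n)" using assms(1) by (fastforce simp: incseq_def decseq_def)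
    show "emeasure lebesgue ({0..1} - K n) \<noteq> \<infinity>" for n
      using fmeasurableD2[OF meas[of n]] by simp
  qed
  moreover have "(\<Inter>n. {0..1} - K n) = {0..1} - (\<Union>n. K n)" by auto
  moreover have "measure lebesgue ({0..1} - (\<Union>n. K n)) = 0"
    using assms(3) by (intro negligible_imp_measure0 negligible_finite)
  ultimately show ?thesis by simp
qed

lemma strict_mono_Homeo01_endpoints:
  assumes "h \<in> carrier Homeo01" "strict_mono_on {0..1} h"
  shows "h 0 = 0" "h 1 = 1"
proof -
  have image: "h ` {0..1} = {0..1}" using bij_betw_imp_surj_on[OF Homeo01_bij[OF assms(1)]] .
  have "0 \<in> h ` {0..1}" "1 \<in> h ` {0..1}" unfolding image by auto
  then obtain x y where "x \<in> {0..1}" "h x = 0" "y \<in> {0..1}" "h y = 1" by (metis imageE)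
  moreover have "h 0 \<in> {0..1}" "h 1 \<in> {0..1}" using image by auto
  ultimately show "h 0 = 0" "h 1 = 1"
    using strict_mono_on_leD[OF assms(2), of 0 x] strict_mono_on_leD[OF assms(2), of y 1] by auto
qed

lemma lo_dyadic: "lo p \<in> dyadic"
proof (induction p)
  case Nil
  then show ?case using dyadic_of_int[of 0] by (simp add: lo_Nil)
next
  case (Cons b p)
  have "lo (b # p) = 2 powi (- 1) * (of_int (of_bool b) + lo p)"
    by (simp add: lo_Cons power_int_minus field_simps)
  then show ?case using Cons by (metis dyadic_add dyadic_mult dyadic_of_int dyadic_power_int)
qed

lemma hi_dyadic: "hi p \<in> dyadic"
proof -
  have "1 / 2 ^ length p = (2 powi (- int (length p)) :: real)"
    by (simp add: power_int_minus inverse_eq_divide)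
  then show ?thesis unfolding hi_eq using lo_dyadic dyadic_add dyadic_power_int by metis
qed

text \<open>The set \<open>K n\<close> is the union of the cells of the leaves of depth at most \<open>n\<close>. Interpolating \<open>h\<close> at
  their end points (and at \<open>0\<close> and \<open>1\<close>) gives an element of Thompson's group that agrees with \<open>h\<close> on
  \<open>K n\<close>, and whose inverse therefore agrees with that of \<open>h\<close> on \<open>h ` K n\<close>. The cells of all leaves miss
  only the finitely many points given by the ends, and their images miss only the images of these
  points, so both exceptional sets have measure tending to \<open>0\<close>.\<close>

lemma triple_homeo_approx:
  assumes t: "(T, U, \<phi>) \<in> tree_triples" and "e > 0"
  defines "h \<equiv> triple_homeo (T, U, \<phi>)"
  shows "\<exists>f\<in>thompson_F. hamming_dist f h < e"
proof -
  have h: "h \<in> carrier Homeo01" "strict_mono_on {0..1} h"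
    and ind: "induces (T, U, \<phi>) h"
    using triple_homeo[OF t] by (simp_all add: h_def)
  note h01 = strict_mono_Homeo01_endpoints[OF h]
  have T: "full_binary_tree T" "finite (ends T)" using t by (auto simp: tree_triples_def)
  have affine: "\<exists>k :: int. \<forall>x\<in>{lo p..hi p}. h x = h (lo p) + 2 powi k * (x - lo p)"
    and dyadic_image: "h (lo p) \<in> dyadic" "h (hi p) \<in> dyadic" if p: "p \<in> leaves T" for p
  proof -
    obtain q where q: "\<phi> (FinBr p) = FinBr q" using triple_leaf[OF t p] .
    have "h x = cell_map (FinBr p) (FinBr q) x" if "x \<in> {lo p..hi p}" for x
      using ind p q that by (simp add: induces_def)
    then have eq: "h x = lo q + 2 powi (int (length p) - int (length q)) * (x - lo p)"
      if "x \<in> {lo p..hi p}" for x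
      using that by (simp add: cell_map_FinBr power_int_diff del: cell_map.simps(1))
    have "h (lo p) = lo q" using eq[of "lo p"] lo_hi_bounds[of p] by simp
    then show "\<exists>k :: int. \<forall>x\<in>{lo p..hi p}. h x = h (lo p) + 2 powi k * (x - lo p)"
      and "h (lo p) \<in> dyadic" using eq lo_dyadic by auto
    have "h (hi p) = hi q"
      using eq[of "hi p"] lo_hi_bounds[of p] by (simp add: hi_eq power_int_diff)
    then show "h (hi p) \<in> dyadic" using hi_dyadic by simp
  qed
  define S where "S n = {p \<in> leaves T. length p \<le> n}" for n
  have fin: "finite (S n)" for n
  proof -
    have "finite {p :: bool list. set p \<subseteq> UNIV \<and> length p \<le> n}" by (rule finite_lists_length_le) simp
    then show ?thesis by (rule rev_finite_subset) (auto simp: S_def)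
  qed
  define K where "K n = (\<Union>p\<in>S n. {lo p..hi p})" for n
  have K: "incseq K" "\<And>n. compact (K n)" "\<And>n. K n \<subseteq> {0..1}"
  proof -
    show "incseq K" by (fastforce simp: incseq_def K_def S_def)
    show "compact (K n)" for n unfolding K_def using fin by (intro compact_UN) auto
    show "K n \<subseteq> {0..1}" for n
      unfolding K_def by (rule UN_least) (use cell_subset[of "FinBr _"] in simp)
  qed
  have uncovered: "{0..1} - (\<Union>n. K n) \<subseteq> binval ` ends T"
  proof
    fix x assume x: "x \<in> {0..1} - (\<Union>n. K n)"
    then obtain u where u: "u \<in> branches T" "x \<in> cell u" using branches_cover[OF T(1)] by blast
    then consider p where "p \<in> leaves T" "u = FinBr p" | w where "w \<in> ends T" "u = InfBr w"
      by (auto simp: branches_def)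
    then show "x \<in> binval ` ends T"
    proof cases
      case 1
      then have "x \<in> K (length p)" using u(2) by (auto simp: K_def S_def)
      then show ?thesis using x by blast
    next
      case 2
      then show ?thesis using u(2) by auto
    qed
  qed
  have fin_K: "finite ({0..1} - (\<Union>n. K n))"
    using uncovered finite_imageI[OF T(2)] by (rule finite_subset)
  have lim: "(\<lambda>n. measure lebesgue ({0..1} - K n)) \<longlonglongrightarrow> 0"
    using K(1,2) fin_K by (rule uncovered_measure_tendsto_0)
  have "h ` {0..1} = {0..1}" using bij_betw_imp_surj_on[OF Homeo01_bij[OF h(1)]] .
  then have "{0..1} - (\<Union>n. h ` K n) = h ` {0..1} - h ` (\<Union>n. K n)" by (simp add: image_UN)
  also have "\<dots> \<subseteq> h ` ({0..1} - (\<Union>n. K n))" by (rule image_diff_subset)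
  finally have fin_hK: "finite ({0..1} - (\<Union>n. h ` K n))"
    using finite_imageI[OF fin_K] by (rule finite_subset)
  have hK: "compact (h ` K n)" for n
    using continuous_on_subset[OF Homeo01_continuous(1)[OF h(1)] K(3)] K(2)
    by (rule compact_continuous_image)
  have "incseq (\<lambda>n. h ` K n)" using K(1) by (simp add: incseq_def image_mono)
  then have lim': "(\<lambda>n. measure lebesgue ({0..1} - h ` K n)) \<longlonglongrightarrow> 0"
    using hK fin_hK by (rule uncovered_measure_tendsto_0)
  have "\<forall>\<^sub>F n in sequentially. measure lebesgue ({0..1} - K n) + measure lebesgue ({0..1} - h ` K n) < e"
    using order_tendstoD(2)[OF tendsto_add[OF lim lim']] \<open>e > 0\<close> by simp
  then obtain n where n: "measure lebesgue ({0..1} - K n) + measure lebesgue ({0..1} - h ` K n) < e"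
    by (auto simp: eventually_sequentially)
  \<comment> \<open>the interpolation lemma adds its leftmost node \<open>0\<close> itself\<close>
  define M where "M = insert 1 (lo ` S n \<union> hi ` S n) - {0}"
  have node: "x \<in> {0..1}" "x \<in> dyadic" "h x \<in> dyadic" if x: "x \<in> insert 0 M" for x
  proof -
    consider "x = 0" | "x = 1" | p where "p \<in> S n" "x = lo p \<or> x = hi p"
      using x unfolding M_def by blast
    then have "x \<in> {0..1} \<and> x \<in> dyadic \<and> h x \<in> dyadic"
    proof cases
      case 3
      then show ?thesis
        using lo_hi_bounds[of p] lo_dyadic[of p] hi_dyadic[of p] dyadic_image[of p]
        by (auto simp: S_def)
    qed (use h01 dyadic_of_int[of 0] dyadic_of_int[of 1] in auto)
    then show "x \<in> {0..1}" "x \<in> dyadic" "h x \<in> dyadic" by auto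
  qed
  have M: "finite M" "M \<subseteq> {0<..}" "insert 0 M \<subseteq> dyadic" "h ` insert 0 M \<subseteq> dyadic"
    "strict_mono_on (insert 0 M) h" and Max: "Max (insert 0 M) = 1"
  proof -
    show fM: "finite M" using fin by (simp add: M_def)
    have "x > 0" if "x \<in> M" for x using node(1)[of x] that by (cases "x = 0") (auto simp: M_def)
    then show "M \<subseteq> {0<..}" by auto
    show "insert 0 M \<subseteq> dyadic" "h ` insert 0 M \<subseteq> dyadic" using node by blast+
    show "strict_mono_on (insert 0 M) h"
      using h(2) node(1) unfolding strict_mono_on_def by blast
    show "Max (insert 0 M) = 1"
      using fM node(1) by (intro Max_eqI) (auto simp: M_def)
  qed
  obtain f where f: "dyadic_PL 0 1 f" "\<forall>x\<in>insert 0 M. f x = h x"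
    and f_eq: "\<forall>x\<in>insert 0 M. \<forall>y\<in>insert 0 M. \<forall>k :: int. x < y \<longrightarrow>
      (\<forall>z\<in>{x..y}. h z = h x + 2 powi k * (z - x)) \<longrightarrow> (\<forall>z\<in>{x..y}. f z = h z)"
    using dyadic_PL_interpolation[OF M] unfolding Max by blast
  define g where "g = restrict f {0..1}"
  have g: "g \<in> thompson_F"
    unfolding g_def using f h01 by (intro dyadic_PL_thompson_F) (auto simp: M_def)
  have gh: "g x = h x" if "x \<in> K n" for x
  proof -
    obtain p where p: "p \<in> S n" "x \<in> {lo p..hi p}" using \<open>x \<in> K n\<close> by (auto simp: K_def)
    moreover have "lo p \<in> insert 0 M" "hi p \<in> insert 0 M" using p(1) by (auto simp: M_def)
    moreover have "p \<in> leaves T" using p(1) by (simp add: S_def)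
    ultimately have "f x = h x" using f_eq affine lo_hi_bounds(2)[of p] by blast
    moreover have "x \<in> {0..1}" using that K(3) by blast
    ultimately show ?thesis by (simp add: g_def)
  qed
  have gH: "g \<in> carrier Homeo01" using g by (rule thompson_F_Homeo01)
  have "{x \<in> {0..1}. g x \<noteq> h x} \<subseteq> {0..1} - K n" using gh by blast
  moreover have "{0..1} - K n \<in> lmeasurable" for n
    using lmeasurable_compact[OF K(2)[of n]] by (intro fmeasurable.Diff) auto
  ultimately have "measure lebesgue {x \<in> {0..1}. g x \<noteq> h x} \<le> measure lebesgue ({0..1} - K n)"
    using differ_lmeasurable[OF Homeo01_continuous(1)[OF gH] Homeo01_continuous(1)[OF h(1)]]
    by (intro measure_mono_fmeasurable) auto
  moreover have "measure lebesgue {y \<in> {0..1}. inv_into {0..1} g y \<noteq> inv_into {0..1} h y}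
      \<le> measure lebesgue ({0..1} - h ` K n)"
  proof (rule measure_mono_fmeasurable)
    show "{y \<in> {0..1}. inv_into {0..1} g y \<noteq> inv_into {0..1} h y} \<subseteq> {0..1} - h ` K n"
    proof -
      have "inv_into {0..1} g y = inv_into {0..1} h y" if "y \<in> h ` K n" for y
      proof -
        obtain x where x: "x \<in> K n" "y = h x" using \<open>y \<in> h ` K n\<close> by blast
        then have "x \<in> {0..1}" using K(3) by blast
        moreover have "inj_on g {0..1}" "inj_on h {0..1}"
          using Homeo01_bij gH h(1) bij_betw_imp_inj_on by blast+
        ultimately have "inv_into {0..1} g (g x) = x" "inv_into {0..1} h (h x) = x"
          by (simp_all only: inv_into_f_f)
        then show ?thesis using x(2) gh[OF x(1)] by simp
      qed
      then show ?thesis by blast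
    qed
    show "{0..1} - h ` K n \<in> lmeasurable"
      using lmeasurable_compact[OF hK[of n]] by (intro fmeasurable.Diff) auto
  qed (use inv_differs_lmeasurable[OF gH h(1)] in auto)
  ultimately have "hamming_dist g h < e" using n by (simp add: hamming_dist_def)
  then show ?thesis using g by blast
qed

theorem theorem7p5:
  shows "tree_F_homeo ` tree_F \<subseteq> F_bar_homeo ` carrier F_bar"
proof
  fix h assume "h \<in> tree_F_homeo ` tree_F"
  then obtain t where t: "t \<in> tree_triples" and h: "h = triple_homeo t"
    by (metis imageE tree_F_homeo_triple)
  obtain T U \<phi> where "t = (T, U, \<phi>)" by (cases t)
  then have "\<exists>f\<in>thompson_F. hamming_dist f h < e" if "e > 0" for e
    using triple_homeo_approx t h that by simp
  then show "h \<in> F_bar_homeo ` carrier F_bar"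
    using triple_homeo[OF t] h by (intro hamming_limit_in_F_bar) auto
qed

end
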